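(* Let $F:[0,\infty)^2\to[0,1]$ be any e-to-p merger satisfying $F\le K_2$ pointwise. Then $F\ge K_2^{\mathrm{ad}}$ pointwise. Consequently, $K_2^{\mathrm{ad}}$ is admissible, and it is the unique admissible merger among all e-to-p mergers that dominate $K_2$.
   Context: An e-variable is a nonnegative random variable $E$ with $\mathbb E[E]\le 1$. A Borel function $F:[0,\infty)^n\to[0,1]$ is an e-to-p merger if $\mathbb P\{F(E_1,\ldots,E_n)\le\alpha\}\le\alpha$ for all $\alpha\in[0,1]$ and every collection of independent e-variables $E_1,\dots,E_n$. A merger $G$ dominates $F$ if $G\le F$ pointwise, and strictly dominates $F$ if in addition $G<F$ at some point. A merger is admissible if no merger strictly dominates it. $K_2(x,y)=\mathbb P\{xD_1+yD_2\le 1\}$ where $(D_0,D_1,D_2)\sim\mathrm{Dirichlet}(1,1,1)$. Explicitly, with $a=\min(x,y)$ and $b=\max(x,y)$: $K_2=1$ if $b\le 1$; $K_2=1-\frac{(b-1)^2}{b(b-a)}$ if $0\le a<1<b$; $K_2=\frac1{ab}$ if $1\le a$. The function $K_2^{\mathrm{ad}}:[0,\infty)^2\to[0,1]$ is symmetric and is defined, with $a$ the minimum and $b$ the maximum of the two arguments, by $$K_2^{\mathrm{ad}}(a,b)=\begin{cases}1,& b\le 1,\\ \dfrac{2}{\tau(a,b)}-\dfrac1{\tau(a,b)^2},& 0\le a<1<b,\\ \dfrac1{ab},& 1\le a,\end{cases}$$ where for $0\le a<1<b$, $\tau(a,b)=\tfrac12\bigl(b(1+a)+\sqrt{b^2(1+a)^2-4ab}\bigr)$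 is the larger root of $t^2-b(1+a)t+ab=0$. *)

theory Defs
  imports "HOL-Probability.Probability"
begin

section \<open>E-variables and e-to-p mergers\<close>

definition e_variable :: "'w measure \<Rightarrow> ('w \<Rightarrow> real) \<Rightarrow> bool" where
  "e_variable M E \<longleftrightarrow>
     (\<forall>\<omega>\<in>space M. 0 \<le> E \<omega>) \<and> integrable M E \<and> integral\<^sup>L M E \<le> 1"

definition nonneg_orthant :: "(real^'n) set" where
  "nonneg_orthant = {x. \<forall>i. 0 \<le> x $ i}"

text \<open>A function on the nonnegative orthant is represented by a total function whose values
  outside the orthant are ignored.  A definition cannot quantify over all types of sample points,
  so the sample points below are fixed to be vectors in \<^typ>\<open>real^'n\<close>.  This is no restriction:
  the joint law of the e-variables lives there, and \<open>e_to_p_merger_any_space\<close> below gives the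
  defining inequality on a probability space over an arbitrary type.\<close>

definition e_to_p_merger :: "(real^'n \<Rightarrow> real) \<Rightarrow> bool" where
  "e_to_p_merger F \<longleftrightarrow>
     F \<in> borel_measurable (restrict_space borel nonneg_orthant) \<and>
     (\<forall>x\<in>nonneg_orthant. F x \<in> {0..1}) \<and>
     (\<forall>(M :: (real^'n) measure) (E :: 'n \<Rightarrow> real^'n \<Rightarrow> real).
        prob_space M \<and> (\<forall>i. e_variable M (E i)) \<and>
        prob_space.indep_vars M (\<lambda>_. borel) E UNIV \<longrightarrow>
        (\<forall>\<alpha>\<in>{0..1}. measure M {\<omega> \<in> space M. F (\<chi> i. E i \<omega>) \<le> \<alpha>} \<le> \<alpha>))"

definition dominates :: "(real^'n \<Rightarrow> real) \<Rightarrow> (real^'n \<Rightarrow> real) \<Rightarrow> bool" where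
  "dominates G F \<longleftrightarrow> (\<forall>x\<in>nonneg_orthant. G x \<le> F x)"

definition strictly_dominates :: "(real^'n \<Rightarrow> real) \<Rightarrow> (real^'n \<Rightarrow> real) \<Rightarrow> bool" where
  "strictly_dominates G F \<longleftrightarrow> dominates G F \<and> (\<exists>x\<in>nonneg_orthant. G x < F x)"

definition admissible_merger :: "(real^'n \<Rightarrow> real) \<Rightarrow> bool" where
  "admissible_merger F \<longleftrightarrow>
     e_to_p_merger F \<and> \<not> (\<exists>G. e_to_p_merger G \<and> strictly_dominates G F)"

lemma e_to_p_merger_any_space:
  fixes F :: "real^'n \<Rightarrow> real" and M :: "'w measure" and E :: "'n \<Rightarrow> 'w \<Rightarrow> real"
  assumes F: "e_to_p_merger F" and M: "prob_space M"
    and E: "\<And>i. e_variable M (E i)"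
    and ind: "prob_space.indep_vars M (\<lambda>_. borel) E UNIV"
    and \<alpha>: "\<alpha> \<in> {0..1}"
  shows "measure M {\<omega> \<in> space M. F (\<chi> i. E i \<omega>) \<le> \<alpha>} \<le> \<alpha>"
proof -
  interpret M: prob_space M by fact
  define R where "R = restrict_space borel (nonneg_orthant :: (real^'n) set)"
  define X where "X = (\<lambda>\<omega>. \<chi> i. E i \<omega>)"
  define N where "N = distr M R X"
  have Em [measurable]: "E i \<in> borel_measurable M" for i
    using E[of i] by (auto simp: e_variable_def)
  have "X \<in> borel_measurable M"
    unfolding X_def
    by (subst borel_measurable_euclidean_space)
       (auto simp: Basis_vec_def inner_axis)
  moreover have "X \<in> space M \<rightarrow> nonneg_orthant"
    using E by (auto simp: X_def nonneg_orthant_def e_variable_def)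
  ultimately have X [measurable]: "X \<in> M \<rightarrow>\<^sub>M R"
    unfolding R_def by (intro measurable_restrict_space2) auto
  interpret N: prob_space N
    unfolding N_def by (rule M.prob_space_distr) (rule X)
  have spN: "space N = nonneg_orthant"
    by (simp add: N_def R_def space_restrict_space)
  have cm: "(\<lambda>x. x $ i) \<in> borel_measurable R" for i :: 'n
    unfolding R_def by (intro measurable_restrict_space1) simp
  have ev: "e_variable N (\<lambda>x. x $ i)" for i
  proof -
    have "(\<lambda>\<omega>. X \<omega> $ i) = E i"
      by (simp add: X_def)
    then have "integrable N (\<lambda>x. x $ i)" "integral\<^sup>L N (\<lambda>x. x $ i) = integral\<^sup>L M (E i)"
      using E[of i] integrable_distr_eq[OF X cm[of i]] integral_distr[OF X cm[of i]]
      unfolding N_def by (simp_all add: e_variable_def)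
    then show ?thesis
      using E[of i] by (auto simp: e_variable_def spN nonneg_orthant_def)
  qed
  have indN: "N.indep_vars (\<lambda>_. borel) (\<lambda>i x. x $ i) UNIV"
    unfolding N.indep_vars_def2 N.indep_sets_def
  proof (intro conjI ballI allI impI)
    show "(\<lambda>x. x $ i) \<in> borel_measurable N" for i
      using cm by (simp add: N_def)
    then show "{(\<lambda>x. x $ i) -` A \<inter> space N |A. A \<in> sets borel} \<subseteq> N.events" for i
      by (auto intro: measurable_sets)
  next
    fix J :: "'n set" and A
    assume J: "J \<noteq> {}" "finite J"
      and "A \<in> Pi J (\<lambda>i. {(\<lambda>x. x $ i) -` A \<inter> space N |A. A \<in> sets borel})"
    then have "\<forall>j\<in>J. \<exists>B. A j = (\<lambda>x. x $ j) -` B \<inter> space N \<and> B \<in> sets borel"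
      by (auto simp: Pi_iff)
    then obtain B where B: "\<And>j. j \<in> J \<Longrightarrow> A j = (\<lambda>x. x $ j) -` B j \<inter> space N"
      "\<And>j. j \<in> J \<Longrightarrow> B j \<in> sets borel"
      by metis
    have As: "A j \<in> sets R" if "j \<in> J" for j
      using measurable_sets[OF cm, of "B j" j] B[OF that] by (simp add: N_def)
    have pre: "X -` A j \<inter> space M = E j -` B j \<inter> space M" if "j \<in> J" for j
      using B(1)[OF that] measurable_space[OF X] by (auto simp: N_def X_def)
    have "N.prob (\<Inter>j\<in>J. A j) = M.prob (X -` (\<Inter>j\<in>J. A j) \<inter> space M)"
      unfolding N_def using As J by (intro measure_distr X sets.finite_INT) auto
    also have "X -` (\<Inter>j\<in>J. A j) \<inter> space M = (\<Inter>j\<in>J. E j -` B j \<inter> space M)"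
      using pre J(1) by blast
    also have "M.prob \<dots> = (\<Prod>j\<in>J. M.prob (E j -` B j \<inter> space M))"
      using ind J B(2) unfolding M.indep_vars_def2
      by (intro M.indep_setsD) auto
    also have "\<dots> = (\<Prod>j\<in>J. N.prob (A j))"
      using As pre by (intro prod.cong refl) (simp add: N_def measure_distr[OF X])
    finally show "N.prob (\<Inter>j\<in>J. A j) = (\<Prod>j\<in>J. N.prob (A j))" .
  qed
  have Fm: "F \<in> borel_measurable R"
    using F by (simp add: e_to_p_merger_def R_def)
  have "measure N {x \<in> space N. F (\<chi> i. x $ i) \<le> \<alpha>} \<le> \<alpha>"
  proof -
    have "prob_space N \<and> (\<forall>i. e_variable N (E' i)) \<and>
        N.indep_vars (\<lambda>_. borel) E' UNIV \<longrightarrow>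
        (\<forall>\<alpha>\<in>{0..1}. measure N {x \<in> space N. F (\<chi> i. E' i x) \<le> \<alpha>} \<le> \<alpha>)"
      for E' :: "'n \<Rightarrow> real^'n \<Rightarrow> real"
      using F unfolding e_to_p_merger_def by blast
    from this[of "\<lambda>i x. x $ i"] show ?thesis
      using N.prob_space_axioms ev indN \<alpha> by simp
  qed
  also have "{x \<in> space N. F (\<chi> i. x $ i) \<le> \<alpha>} = {x \<in> space R. F x \<le> \<alpha>}"
    by (simp add: N_def)
  also have "measure N \<dots> = measure M (X -` {x \<in> space R. F x \<le> \<alpha>} \<inter> space M)"
    unfolding N_def using Fm by (intro measure_distr X) measurable
  also have "X -` {x \<in> space R. F x \<le> \<alpha>} \<inter> space M = {\<omega> \<in> space M. F (\<chi> i. E i \<omega>) \<le> \<alpha>}"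
    using measurable_space[OF X] by (auto simp: X_def)
  finally show ?thesis .
qed

section \<open>The function \<open>K\<^sub>2\<close>\<close>

text \<open>The density of \<open>(D\<^sub>1, D\<^sub>2)\<close> with respect to Lebesgue measure on the plane,
  for \<open>(D\<^sub>0, D\<^sub>1, D\<^sub>2)\<close> Dirichlet distributed; \<open>D\<^sub>0 = 1 - D\<^sub>1 - D\<^sub>2\<close>.\<close>

definition dirichlet3_density :: "real \<Rightarrow> real \<Rightarrow> real \<Rightarrow> real \<times> real \<Rightarrow> real" where
  "dirichlet3_density \<alpha>0 \<alpha>1 \<alpha>2 = (\<lambda>(d1, d2).
     if 0 < d1 \<and> 0 < d2 \<and> d1 + d2 < 1
     then Gamma (\<alpha>0 + \<alpha>1 + \<alpha>2) / (Gamma \<alpha>0 * Gamma \<alpha>1 * Gamma \<alpha>2)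
            * (1 - d1 - d2) powr (\<alpha>0 - 1) * d1 powr (\<alpha>1 - 1) * d2 powr (\<alpha>2 - 1)
     else 0)"

definition dirichlet3 :: "real \<Rightarrow> real \<Rightarrow> real \<Rightarrow> (real \<times> real \<times> real) measure" where
  "dirichlet3 \<alpha>0 \<alpha>1 \<alpha>2 =
     distr (density lborel (\<lambda>d. ennreal (dirichlet3_density \<alpha>0 \<alpha>1 \<alpha>2 d))) borel
       (\<lambda>(d1, d2). (1 - d1 - d2, d1, d2))"

definition K2 :: "real^2 \<Rightarrow> real" where
  "K2 x = measure (dirichlet3 1 1 1) {(d0, d1, d2). x $ 1 * d1 + x $ 2 * d2 \<le> 1}"

section \<open>The function \<open>K\<^sub>2\<^sup>a\<^sup>d\<close>\<close>

definition tau :: "real \<Rightarrow> real \<Rightarrow> real" where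
  "tau a b = (b * (1 + a) + sqrt (b\<^sup>2 * (1 + a)\<^sup>2 - 4 * a * b)) / 2"

definition K2_ad :: "real^2 \<Rightarrow> real" where
  "K2_ad x =
     (let a = min (x $ 1) (x $ 2); b = max (x $ 1) (x $ 2) in
      if b \<le> 1 then 1
      else if a < 1 then 2 / tau a b - 1 / (tau a b)\<^sup>2
      else 1 / (a * b))"

end

theory Submission
  imports Defs
begin

text \<open>
  Everything rests on two-point laws.  If \<open>X\<close> is an e-variable and \<open>f\<close> is nondecreasing, then
  \<open>\<integral> f(X) \<le> \<beta>\<close> as soon as this holds for all laws with mean 1 on two points \<open>u \<le> 1 < v\<close>: the
  two-point inequalities say that some line through \<open>(1, \<beta>)\<close> with nonnegative slope lies above
  \<open>f\<close>, and integrating the line finishes the argument (\<open>expectation_le_by_two_point_laws\<close>).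
  Used once in each coordinate, this bounds the probability of an upward closed planar region by
  the probabilities under products of two two-point laws (\<open>prob_le_by_two_point_laws\<close>).

  Write a level as \<open>\<alpha> = 2/t - 1/t\<^sup>2 = 1 - (1 - 1/t)\<^sup>2\<close> with \<open>t > 1\<close>.  The region where \<open>K2_ad\<close> is at
  most \<open>\<alpha>\<close> has a simple description (\<open>K2_ad_le_iff\<close>), because \<open>tau a b \<ge> t\<close> means
  \<open>b (t + a (t - 1)) \<ge> t\<^sup>2\<close>.  For this region the four-point inequality is elementary
  (\<open>four_point_bound\<close>), so \<open>K2_ad\<close> is a merger.  The hard configuration is the one where only the
  pair of lower atoms is accepted; there equality is possible when one lower atom is 0.

  That equality case dictates the lower bound.  Let \<open>F\<close> be a merger below \<open>K2\<close> and let
  \<open>a < 1 < b\<close>.  Put one e-variable on \<open>{a, t}\<close> and the other on \<open>{0, b}\<close>, both with mean 1.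
  Since \<open>K2 (t, 0) = 2/t - 1/t\<^sup>2 = \<alpha>\<close> and \<open>K2 (t, b) = 1/(tb) \<le> \<alpha>\<close>, the function \<open>F\<close> is at most
  \<open>\<alpha>\<close> at these two points.  If it were at most \<open>\<alpha>\<close> at \<open>(a, b)\<close> too, validity would force
  \<open>t \<le> tau a b\<close>.  So \<open>F (a, b) > 2/t - 1/t\<^sup>2\<close> for every \<open>t > tau a b\<close>, and \<open>t \<rightarrow> tau a b\<close> gives
  \<open>F (a, b) \<ge> K2_ad (a, b)\<close> (\<open>K2_ad_ordered_lower\<close>).  The other two cases use a constant pair and the
  laws on \<open>{0, a}\<close> and \<open>{0, b}\<close>.

  Finally \<open>K2_ad \<le> K2\<close> follows from the closed form of \<open>K2\<close>, an area computation
  (\<open>K2_eq_closed_form\<close>), and an algebraic inequality.  So \<open>K2_ad\<close> is a merger below \<open>K2\<close> and is below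
  every such merger; being the least such merger, it is admissible, and no other merger below \<open>K2\<close> is.
\<close>

section \<open>Level sets of the improved merger\<close>

lemma tau_quadratic:
  fixes a b :: real
  assumes "0 \<le> a" "a < 1" "1 < b"
  shows "(tau a b)\<^sup>2 - b * (1 + a) * tau a b + a * b = 0" and "b \<le> tau a b"
proof -
  define D where "D = b\<^sup>2 * (1 + a)\<^sup>2 - 4 * a * b"
  have D: "D = (b * (1 - a))\<^sup>2 + 4 * a * b * (b - 1)"
    by (simp add: D_def power2_eq_square algebra_simps)
  have "(b * (1 - a))\<^sup>2 \<le> D"
    using assms by (simp add: D)
  then have sq: "b * (1 - a) \<le> sqrt D" and D0: "0 \<le> D"
    using assms by (auto intro: real_le_rsqrt order_trans[OF zero_le_power2])
  have t: "tau a b = (b * (1 + a) + sqrt D) / 2"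
    by (simp add: tau_def D_def)
  have "(sqrt D)\<^sup>2 = D" using D0 by simp
  then have "4 * ((tau a b)\<^sup>2 - b * (1 + a) * tau a b + a * b) = 0"
    unfolding t by (simp add: D_def power2_eq_square field_simps)
  then show "(tau a b)\<^sup>2 - b * (1 + a) * tau a b + a * b = 0" by simp
  show "b \<le> tau a b" using sq unfolding t by (simp add: algebra_simps)
qed

text \<open>The quadratic with larger root \<open>tau a b\<close> is negative at 1, so its smaller root lies below 1 and
  its sign at \<open>t > 1\<close> only depends on the position of \<open>t\<close> relative to \<open>tau a b\<close>.\<close>
lemma quadratic_sign_tau:
  fixes a b t :: real
  assumes ab: "0 \<le> a" "a < 1" "1 < b" and t: "1 < t"
  shows "t \<le> tau a b \<longleftrightarrow> t\<^sup>2 \<le> b * (t + a * (t - 1))"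
proof -
  define s where "s = b * (1 + a) - tau a b"
  have q: "t'\<^sup>2 - b * (t' + a * (t' - 1)) = (t' - tau a b) * (t' - s)" for t'
    using tau_quadratic(1)[OF ab] by (simp add: s_def power2_eq_square algebra_simps)
  have "(1 - tau a b) * (1 - s) < 0"
    using q[of 1] ab by simp
  then have "s < 1"
    using tau_quadratic(2)[OF ab] ab by (auto simp: mult_less_0_iff)
  then have "t - s > 0" using t by simp
  then have "(t - tau a b) * (t - s) \<le> 0 \<longleftrightarrow> t \<le> tau a b"
    by (auto simp: mult_le_0_iff)
  then show ?thesis using q[of t] by auto
qed

lemma level_decreasing_iff:
  fixes s t :: real
  assumes "1 \<le> s" "1 < t"
  shows "2 / s - 1 / s\<^sup>2 \<le> 2 / t - 1 / t\<^sup>2 \<longleftrightarrow> t \<le> s"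
proof -
  have p: "1/s \<le> 1" "1/t < 1" using assms by auto
  have "2 / s - 1 / s\<^sup>2 \<le> 2 / t - 1 / t\<^sup>2 \<longleftrightarrow> (1/s - 1/t) * (2 - 1/s - 1/t) \<le> 0"
    by (simp add: power2_eq_square algebra_simps)
  also have "\<dots> \<longleftrightarrow> 1/s \<le> 1/t"
    using p by (auto simp: mult_le_0_iff)
  also have "\<dots> \<longleftrightarrow> t \<le> s"
    using assms by (simp add: divide_simps)
  finally show ?thesis .
qed

definition K2_ad_ordered :: "real \<Rightarrow> real \<Rightarrow> real" where
  "K2_ad_ordered a b = (if b \<le> 1 then 1 else if a < 1 then 2 / tau a b - 1 / (tau a b)\<^sup>2 else 1 / (a * b))"

lemma K2_ad_eq_ordered: "K2_ad x = K2_ad_ordered (min (x $ 1) (x $ 2)) (max (x $ 1) (x $ 2))"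
  by (simp add: K2_ad_def K2_ad_ordered_def Let_def)

text \<open>One formula for three regions: for \<open>x \<le> 1 \<le> y\<close> it reads \<open>t\<^sup>2 \<le> y (t + (t - 1) x)\<close>, for
  \<open>x, y \<ge> 1\<close> it reads \<open>t\<^sup>2 \<le> x y (2t - 1)\<close>, and for \<open>x, y \<le> 1\<close> and \<open>t > 1\<close> it fails.  In this form
  symmetry and monotonicity are visible.\<close>
definition rejects :: "real \<Rightarrow> real \<Rightarrow> real \<Rightarrow> bool" where
  "rejects t x y \<longleftrightarrow> t\<^sup>2 \<le> max x 1 * max y 1 * (t + (t - 1) * (min x 1 * min y 1))"

lemma rejects_commute: "rejects t x y \<longleftrightarrow> rejects t y x"
  by (simp add: rejects_def mult_ac)

lemma rejects_mono:
  assumes "rejects t x y" "0 \<le> x" "x \<le> x'" "0 \<le> y" "y \<le> y'" "1 < t"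
  shows "rejects t x' y'"
proof -
  have "max x 1 * max y 1 * (t + (t - 1) * (min x 1 * min y 1))
      \<le> max x' 1 * max y' 1 * (t + (t - 1) * (min x' 1 * min y' 1))"
    using assms by (intro mult_mono add_mono order_refl mult_nonneg_nonneg add_nonneg_nonneg) auto
  then show ?thesis using assms(1) by (simp add: rejects_def)
qed

lemma K2_ad_le_iff:
  assumes x: "0 \<le> x $ 1" "0 \<le> x $ 2" and t: "1 < t"
  shows "K2_ad x \<le> 2 / t - 1 / t\<^sup>2 \<longleftrightarrow> rejects t (x $ 1) (x $ 2)"
proof -
  define a b where "a = min (x $ 1) (x $ 2)" and "b = max (x $ 1) (x $ 2)"
  have ab: "0 \<le> a" "a \<le> b" using x by (auto simp: a_def b_def)
  have r: "rejects t (x $ 1) (x $ 2) \<longleftrightarrow> rejects t a b"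
    using rejects_commute by (auto simp: a_def b_def min_def max_def)
  have K: "K2_ad x = (if b \<le> 1 then 1 else if a < 1 then 2 / tau a b - 1 / (tau a b)\<^sup>2
      else 1 / (a * b))"
    by (simp add: K2_ad_eq_ordered K2_ad_ordered_def a_def b_def)
  have t2: "t\<^sup>2 > 0" using t by simp
  consider "b \<le> 1" | "a < 1" "1 < b" | "1 \<le> a" "1 < b" by linarith
  then have "K2_ad x \<le> 2 / t - 1 / t\<^sup>2 \<longleftrightarrow> rejects t a b"
  proof cases
    case 1
    have "(t - 1)\<^sup>2 > 0" using t by simp
    then have sq: "2 * t - 1 < t\<^sup>2" by (simp add: power2_eq_square algebra_simps)
    have "2 / t - 1 / t\<^sup>2 < 1" using sq t by (simp add: power2_eq_square field_simps)
    moreover have "(t - 1) * (a * b) \<le> (t - 1) * 1"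
      using 1 ab t by (intro mult_left_mono mult_le_one) auto
    ultimately show ?thesis using 1 ab sq by (simp add: K rejects_def)
  next
    case 2
    have "K2_ad x \<le> 2 / t - 1 / t\<^sup>2 \<longleftrightarrow> t \<le> tau a b"
      using 2 tau_quadratic(2)[OF ab(1) 2] t by (simp add: K level_decreasing_iff)
    then show ?thesis
      using 2 quadratic_sign_tau[OF ab(1) 2 t] by (simp add: rejects_def mult_ac)
  next
    case 3
    have "K2_ad x \<le> 2 / t - 1 / t\<^sup>2 \<longleftrightarrow> 1 / (a * b) \<le> (2 * t - 1) / t\<^sup>2"
      using 3 t by (simp add: K power2_eq_square field_simps)
    also have "\<dots> \<longleftrightarrow> t\<^sup>2 \<le> a * b * (2 * t - 1)"
      using 3 t2 by (simp add: divide_simps mult_ac)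
    finally show ?thesis using 3 by (simp add: rejects_def mult_ac)
  qed
  then show ?thesis using r by simp
qed

section \<open>Two-point laws are extremal\<close>

text \<open>The hypothesis \<open>two\<close> compares slopes: every chord from \<open>(1, \<beta>)\<close> to a point of the graph on
  the right is at most as steep as every chord to a point on the left.  The infimum \<open>c\<close> of the
  left slopes therefore gives a line through \<open>(1, \<beta>)\<close> above \<open>f\<close>.  Monotonicity makes
  \<open>c \<ge> 0\<close>, so a mean below 1 can only help.\<close>
lemma expectation_le_by_two_point_laws:
  fixes f :: "real \<Rightarrow> real"
  assumes M: "prob_space M" and X: "e_variable M X"
    and f: "integrable M (\<lambda>\<omega>. f (X \<omega>))"
    and mono: "\<And>u v. 0 \<le> u \<Longrightarrow> u \<le> v \<Longrightarrow> f u \<le> f v"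
    and two: "\<And>u v. 0 \<le> u \<Longrightarrow> u \<le> 1 \<Longrightarrow> 1 < v \<Longrightarrow> f u * (v - 1) + f v * (1 - u) \<le> \<beta> * (v - u)"
  shows "(\<integral>\<omega>. f (X \<omega>) \<partial>M) \<le> \<beta>"
proof -
  interpret prob_space M by fact
  define S where "S = (\<lambda>u. (\<beta> - f u) / (1 - u)) ` {0..<1}"
  define c where "c = Inf S"
  have f1: "f 1 \<le> \<beta>" using two[of 1 2] by simp
  have lb: "(f v - \<beta>) / (v - 1) \<le> s" if v: "1 < v" and s: "s \<in> S" for v s
  proof -
    obtain u where u: "0 \<le> u" "u < 1" "s = (\<beta> - f u) / (1 - u)"
      using s by (auto simp: S_def)
    have "(f v - \<beta>) * (1 - u) \<le> (\<beta> - f u) * (v - 1)"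
      using two[of u v] u that by (simp add: algebra_simps)
    then show ?thesis using u(1,2) v unfolding u(3) by (simp add: divide_simps mult_ac)
  qed
  have nn: "0 \<le> s" if "s \<in> S" for s
    using that mono[of _ 1] f1 by (force simp: S_def intro!: divide_nonneg_nonneg)
  have ne: "S \<noteq> {}" by (auto simp: S_def)
  have bdd: "bdd_below S" by (rule bdd_belowI[of _ 0]) (rule nn)
  have c0: "0 \<le> c" unfolding c_def by (rule cInf_greatest[OF ne nn])
  have line: "f x \<le> \<beta> + c * (x - 1)" if "0 \<le> x" for x
  proof -
    consider "x < 1" | "x = 1" | "1 < x" by linarith
    then show ?thesis
    proof cases
      case 1
      then have "c \<le> (\<beta> - f x) / (1 - x)"
        unfolding c_def using that by (intro cInf_lower bdd) (auto simp: S_def)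
      then have "c * (1 - x) \<le> \<beta> - f x" using 1 by (simp add: pos_le_divide_eq)
      then show ?thesis by (simp add: algebra_simps)
    next
      case 2
      then show ?thesis using f1 by simp
    next
      case 3
      have "(f x - \<beta>) / (x - 1) \<le> c"
        unfolding c_def using 3 by (intro cInf_greatest ne lb)
      then show ?thesis using 3 by (simp add: pos_divide_le_eq)
    qed
  qed
  have X': "integrable M X" "(\<integral>\<omega>. X \<omega> \<partial>M) \<le> 1" "\<And>\<omega>. \<omega> \<in> space M \<Longrightarrow> 0 \<le> X \<omega>"
    using X by (auto simp: e_variable_def)
  have "(\<integral>\<omega>. f (X \<omega>) \<partial>M) \<le> (\<integral>\<omega>. \<beta> + c * (X \<omega> - 1) \<partial>M)"
    using X' line by (intro integral_mono f) auto
  also have "\<dots> = \<beta> + c * ((\<integral>\<omega>. X \<omega> \<partial>M) - 1)"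
    using X' by (simp add: prob_space)
  also have "\<dots> \<le> \<beta>"
    using X' c0 by (simp add: mult_nonneg_nonpos)
  finally show ?thesis .
qed

lemma (in prob_space) prob_indep_pair:
  fixes R :: "real \<Rightarrow> real \<Rightarrow> bool"
  assumes "indep_var borel X borel Y" and [measurable]: "Measurable.pred (borel \<Otimes>\<^sub>M borel) (\<lambda>(x, y). R x y)"
  shows "prob {\<omega> \<in> space M. R (X \<omega>) (Y \<omega>)} = (\<integral>\<omega>. prob {\<omega>' \<in> space M. R (X \<omega>) (Y \<omega>')} \<partial>M)"
    and "integrable M (\<lambda>\<omega>. prob {\<omega>' \<in> space M. R (X \<omega>) (Y \<omega>')})"
proof -
  have X[measurable]: "X \<in> borel_measurable M" and Y[measurable]: "Y \<in> borel_measurable M"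
    and eq: "distr M borel X \<Otimes>\<^sub>M distr M borel Y = distr M (borel \<Otimes>\<^sub>M borel) (\<lambda>\<omega>. (X \<omega>, Y \<omega>))"
    using assms(1) by (auto simp: indep_var_distribution_eq)
  interpret PX: prob_space "distr M borel X" by (rule prob_space_distr) simp
  interpret PY: prob_space "distr M borel Y" by (rule prob_space_distr) simp
  define A where "A = {(x, y). R x y}"
  have A: "A \<in> sets (borel \<Otimes>\<^sub>M borel)"
  proof -
    have "{p \<in> space (borel \<Otimes>\<^sub>M borel). case p of (x, y) \<Rightarrow> R x y} \<in> sets (borel \<Otimes>\<^sub>M borel)"
      by (rule predE[OF assms(2)])
    also have "{p \<in> space (borel \<Otimes>\<^sub>M borel). case p of (x, y) \<Rightarrow> R x y} = A"
      by (auto simp: A_def space_pair_measure)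
    finally show ?thesis .
  qed
  have slice: "measure (distr M borel Y) (Pair x -` A) = prob {\<omega>' \<in> space M. R x (Y \<omega>')}" for x
  proof -
    have "Pair x -` A \<in> sets borel" using A by (rule sets_Pair1)
    then have "measure (distr M borel Y) (Pair x -` A) = prob (Y -` (Pair x -` A) \<inter> space M)"
      by (intro measure_distr) auto
    also have "Y -` (Pair x -` A) \<inter> space M = {\<omega>' \<in> space M. R x (Y \<omega>')}"
      by (auto simp: A_def)
    finally show ?thesis .
  qed
  have m: "(\<lambda>x. measure (distr M borel Y) (Pair x -` A)) \<in> borel_measurable borel"
    using A PY.measurable_emeasure_Pair[of A borel]
    by (simp add: measure_def)
  have m': "(\<lambda>x. prob {\<omega>' \<in> space M. R x (Y \<omega>')}) \<in> borel_measurable borel"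
    using m by (simp add: slice)
  show int: "integrable M (\<lambda>\<omega>. prob {\<omega>' \<in> space M. R (X \<omega>) (Y \<omega>')})"
    using measurable_compose[OF X m'] by (intro integrable_const_bound[where B=1]) auto
  have "ennreal (prob {\<omega> \<in> space M. R (X \<omega>) (Y \<omega>)})
      = emeasure (distr M (borel \<Otimes>\<^sub>M borel) (\<lambda>\<omega>. (X \<omega>, Y \<omega>))) A"
    using A by (subst emeasure_distr) (auto simp: A_def emeasure_eq_measure intro!: arg_cong[where f=prob])
  also have "\<dots> = (\<integral>\<^sup>+x. emeasure (distr M borel Y) (Pair x -` A) \<partial>distr M borel X)"
    unfolding eq[symmetric] by (rule PY.emeasure_pair_measure_alt) (simp add: A)
  also have "\<dots> = (\<integral>\<^sup>+x. ennreal (prob {\<omega>' \<in> space M. R x (Y \<omega>')}) \<partial>distr M borel X)"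
    by (simp add: PY.emeasure_eq_measure slice)
  also have "\<dots> = (\<integral>\<^sup>+\<omega>. ennreal (prob {\<omega>' \<in> space M. R (X \<omega>) (Y \<omega>')}) \<partial>M)"
    using m' by (intro nn_integral_distr) auto
  also have "\<dots> = ennreal (\<integral>\<omega>. prob {\<omega>' \<in> space M. R (X \<omega>) (Y \<omega>')} \<partial>M)"
    using int by (intro nn_integral_eq_integral) auto
  finally show "prob {\<omega> \<in> space M. R (X \<omega>) (Y \<omega>)} = (\<integral>\<omega>. prob {\<omega>' \<in> space M. R (X \<omega>) (Y \<omega>')} \<partial>M)"
    by (subst (asm) ennreal_inj) (auto intro!: integral_nonneg_AE)
qed

text \<open>Two-point reduction in both coordinates: with the law of \<open>Y\<close> fixed, the slice probability is
  a nondecreasing function of the value of \<open>X\<close>; its two-point inequality is again a statement about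
  the expectation of a nondecreasing function of \<open>Y\<close>.\<close>
lemma (in prob_space) prob_le_by_two_point_laws:
  assumes X: "e_variable M X" and Y: "e_variable M Y" and ind: "indep_var borel X borel Y"
    and R[measurable]: "Measurable.pred (borel \<Otimes>\<^sub>M borel) (\<lambda>(x, y). R x y)"
    and mono: "\<And>x x' y y'. R x y \<Longrightarrow> 0 \<le> x \<Longrightarrow> x \<le> x' \<Longrightarrow> 0 \<le> y \<Longrightarrow> y \<le> y' \<Longrightarrow> R x' y'"
    and four: "\<And>u v u' v'. 0 \<le> u \<Longrightarrow> u \<le> 1 \<Longrightarrow> 0 \<le> u' \<Longrightarrow> u' \<le> 1 \<Longrightarrow> 1 < v \<Longrightarrow> 1 < v' \<Longrightarrow>
       (of_bool (R u u') * (v - 1) + of_bool (R v u') * (1 - u)) * (v' - 1)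
       + (of_bool (R u v') * (v - 1) + of_bool (R v v') * (1 - u)) * (1 - u')
       \<le> \<alpha> * (v - u) * (v' - u')"
  shows "prob {\<omega> \<in> space M. R (X \<omega>) (Y \<omega>)} \<le> \<alpha>"
proof -
  have Xm[measurable]: "X \<in> borel_measurable M" and Ym[measurable]: "Y \<in> borel_measurable M"
    using X Y by (auto simp: e_variable_def)
  have Y0: "\<And>\<omega>. \<omega> \<in> space M \<Longrightarrow> 0 \<le> Y \<omega>"
    using Y by (auto simp: e_variable_def)
  have Rm[measurable]: "{\<omega> \<in> space M. R x (Y \<omega>)} \<in> events" for x
  proof -
    have "Measurable.pred M (\<lambda>\<omega>. (\<lambda>(x, y). R x y) (x, Y \<omega>))" by measurable
    then show ?thesis by (simp add: pred_def)
  qed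
  have Ri: "integrable M (\<lambda>\<omega>. of_bool (R x (Y \<omega>)) :: real)"
    and Rp: "(\<integral>\<omega>. of_bool (R x (Y \<omega>)) \<partial>M) = prob {\<omega> \<in> space M. R x (Y \<omega>)}" for x
  proof -
    have e: "integrable M (\<lambda>\<omega>. of_bool (R x (Y \<omega>)) :: real)
        \<longleftrightarrow> integrable M (indicator {\<omega> \<in> space M. R x (Y \<omega>)} :: _ \<Rightarrow> real)"
      by (intro Bochner_Integration.integrable_cong) (auto simp: indicator_def)
    show "integrable M (\<lambda>\<omega>. of_bool (R x (Y \<omega>)) :: real)"
      unfolding e by (rule integrable_real_indicator) (auto simp: emeasure_eq_measure)
    have "(\<integral>\<omega>. of_bool (R x (Y \<omega>)) \<partial>M) = (\<integral>\<omega>. indicator {\<omega> \<in> space M. R x (Y \<omega>)} \<omega> \<partial>M :: real)"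
      by (intro Bochner_Integration.integral_cong) (auto simp: indicator_def)
    then show "(\<integral>\<omega>. of_bool (R x (Y \<omega>)) \<partial>M) = prob {\<omega> \<in> space M. R x (Y \<omega>)}" by simp
  qed
  have "(\<integral>\<omega>. prob {\<omega>' \<in> space M. R (X \<omega>) (Y \<omega>')} \<partial>M) \<le> \<alpha>"
  proof (rule expectation_le_by_two_point_laws[OF prob_space_axioms X])
    show "integrable M (\<lambda>\<omega>. prob {\<omega>' \<in> space M. R (X \<omega>) (Y \<omega>')})"
      by (rule prob_indep_pair(2)[OF ind R])
    show "prob {\<omega> \<in> space M. R u (Y \<omega>)} \<le> prob {\<omega> \<in> space M. R v (Y \<omega>)}" if "0 \<le> u" "u \<le> v" for u v
      using that mono Y0 by (intro finite_measure_mono Rm) blast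
    fix u v :: real
    assume uv: "0 \<le> u" "u \<le> 1" "1 < v"
    define g where "g = (\<lambda>y. of_bool (R u y) * (v - 1) + of_bool (R v y) * (1 - u))"
    have "(\<integral>\<omega>. g (Y \<omega>) \<partial>M) \<le> \<alpha> * (v - u)"
    proof (rule expectation_le_by_two_point_laws[OF prob_space_axioms Y])
      show "integrable M (\<lambda>\<omega>. g (Y \<omega>))" unfolding g_def using Ri by auto
      show "g y \<le> g y'" if "0 \<le> y" "y \<le> y'" for y y'
        unfolding g_def using uv that mono[of u y u y'] mono[of v y v y']
        by (intro add_mono mult_right_mono) auto
      show "g u' * (v' - 1) + g v' * (1 - u') \<le> \<alpha> * (v - u) * (v' - u')"
        if "0 \<le> u'" "u' \<le> 1" "1 < v'" for u' v'
        unfolding g_def using four[of u u' v v'] uv that by simp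
    qed
    moreover have "(\<integral>\<omega>. g (Y \<omega>) \<partial>M)
        = prob {\<omega> \<in> space M. R u (Y \<omega>)} * (v - 1) + prob {\<omega> \<in> space M. R v (Y \<omega>)} * (1 - u)"
      unfolding g_def using Ri by (simp add: Rp)
    ultimately show "prob {\<omega> \<in> space M. R u (Y \<omega>)} * (v - 1) + prob {\<omega> \<in> space M. R v (Y \<omega>)} * (1 - u)
        \<le> \<alpha> * (v - u)" by simp
  qed
  then show ?thesis by (simp add: prob_indep_pair(1)[OF ind R])
qed

section \<open>The improved merger is an e-to-p merger\<close>

lemma upper_times_complement_le:
  fixes u v :: real
  assumes "0 \<le> u" "u \<le> 1" "1 < v"
  shows "v * (1 - u) \<le> v - u"
  using assms mult_right_mono[of 1 v u] by (simp add: algebra_simps)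

text \<open>The acceptance probabilities of the lower atoms are \<open>(v - 1)/(v - u)\<close> and
  \<open>(v' - 1)/(v' - u')\<close>, increasing in \<open>v\<close> and \<open>v'\<close>, so the extreme case is equality in the two
  rejection conditions.  There the claim is \<open>P Q \<le> t\<^sup>2 (t - u) (t - u')\<close> for the \<open>P\<close>, \<open>Q\<close> below, and the
  difference of the two sides has the factor \<open>u u' (t - 1)\<close>.\<close>
lemma both_rejected_bound:
  fixes t u v u' v' :: real
  assumes t: "1 < t" and u: "0 \<le> u" "u \<le> 1" "0 \<le> u'" "u' \<le> 1" and v: "1 < v" "1 < v'"
    and r: "t\<^sup>2 \<le> v * (t + (t - 1) * u')" "t\<^sup>2 \<le> v' * (t + (t - 1) * u)"
  shows "(t - 1)\<^sup>2 * ((v - u) * (v' - u')) \<le> t\<^sup>2 * ((v - 1) * (v' - 1))"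
proof -
  have lower: "(t - 1) * (t - w') * (z - w) \<le> (z - 1) * (t\<^sup>2 - w * t - w * w' * (t - 1))"
    if "0 \<le> w" "w \<le> 1" "0 \<le> w'" "w' \<le> 1" "t\<^sup>2 \<le> z * (t + (t - 1) * w')" for w w' z
  proof -
    have "(z - 1) * (t\<^sup>2 - w * t - w * w' * (t - 1)) - (t - 1) * (t - w') * (z - w)
        = (1 - w) * (z * (t + (t - 1) * w') - t\<^sup>2)"
      by (simp add: power2_eq_square algebra_simps)
    also have "\<dots> \<ge> 0" using that by simp
    finally show ?thesis by simp
  qed
  define P where "P = t\<^sup>2 - u * t - u * u' * (t - 1)"
  define Q where "Q = t\<^sup>2 - u' * t - u' * u * (t - 1)"
  have pos: "0 < t\<^sup>2 - w * t - w * w' * (t - 1)"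
    if "0 \<le> w" "w \<le> 1" "0 \<le> w'" "w' \<le> 1" for w w'
  proof -
    have "w * t \<le> 1 * t" using that t by (intro mult_right_mono) auto
    moreover have "w * w' * (t - 1) \<le> 1 * (t - 1)"
      using that t by (intro mult_right_mono mult_le_one) auto
    moreover have "(t - 1)\<^sup>2 > 0" using t by simp
    ultimately show ?thesis by (simp add: power2_eq_square algebra_simps)
  qed
  have PQ: "0 < P" "0 < Q" using pos u by (auto simp: P_def Q_def)
  have 1: "(t - 1) * (t - u') * (v - u) \<le> (v - 1) * P"
    using lower[of u u' v] u r by (simp add: P_def)
  have 2: "(t - 1) * (t - u) * (v' - u') \<le> (v' - 1) * Q"
    using lower[of u' u v'] u r by (simp add: Q_def)
  have "u * u' * (t - 1) \<le> 1 * (t - 1)" "(u + u') * t \<le> 2 * t" "2 * t * (t - 1) \<ge> 1 * (t - 1)"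
    using u t by (intro mult_right_mono mult_le_one; simp)+
  then have "0 \<le> 2 * t\<^sup>2 - t * (u + u') - u * u' * (t - 1)"
    by (simp add: power2_eq_square algebra_simps)
  then have "0 \<le> u * u' * (t - 1) * (2 * t\<^sup>2 - t * (u + u') - u * u' * (t - 1))"
    using u t by simp
  also have "\<dots> = t\<^sup>2 * ((t - u) * (t - u')) - P * Q"
    by (simp add: P_def Q_def power2_eq_square algebra_simps)
  finally have 3: "P * Q \<le> t\<^sup>2 * ((t - u) * (t - u'))" by simp
  have "(P * Q) * ((t - 1)\<^sup>2 * ((v - u) * (v' - u')))
      \<le> t\<^sup>2 * ((t - u) * (t - u')) * ((t - 1)\<^sup>2 * ((v - u) * (v' - u')))"
    using 3 u v by (intro mult_right_mono) auto
  also have "\<dots> = t\<^sup>2 * (((t - 1) * (t - u') * (v - u)) * ((t - 1) * (t - u) * (v' - u')))"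
    by (simp add: power2_eq_square mult_ac)
  also have "\<dots> \<le> t\<^sup>2 * (((v - 1) * P) * ((v' - 1) * Q))"
    using u v t PQ by (intro mult_left_mono mult_mono[OF 1 2] mult_nonneg_nonneg) auto
  also have "\<dots> = (P * Q) * (t\<^sup>2 * ((v - 1) * (v' - 1)))"
    by (simp add: mult_ac)
  finally show ?thesis using PQ by simp
qed

text \<open>After division by \<open>(v - u) (v' - u')\<close> the left side is the rejection probability under the
  product of the mean-one laws on \<open>{u, v}\<close> and \<open>{u', v'}\<close>.  The pair \<open>(u, u')\<close> is never rejected.  If
  one of the mixed pairs is accepted, rejection forces an e-variable with lower atom \<open>w\<close> to take its
  upper value \<open>z\<close>, which has probability at most \<open>1/z\<close>.\<close>
lemma four_point_bound:
  fixes t u v u' v' :: real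
  assumes t: "1 < t" and u: "0 \<le> u" "u \<le> 1" "0 \<le> u'" "u' \<le> 1" and v: "1 < v" "1 < v'"
  shows "(of_bool (rejects t u u') * (v - 1) + of_bool (rejects t v u') * (1 - u)) * (v' - 1)
       + (of_bool (rejects t u v') * (v - 1) + of_bool (rejects t v v') * (1 - u)) * (1 - u')
       \<le> (2 / t - 1 / t\<^sup>2) * (v - u) * (v' - u')"
    (is "?L \<le> ?R")
proof -
  define \<alpha> where "\<alpha> = 2 / t - 1 / t\<^sup>2"
  have t\<alpha>: "t\<^sup>2 * \<alpha> = 2 * t - 1" and \<alpha>: "0 \<le> \<alpha>"
    using t by (auto simp: \<alpha>_def power2_eq_square field_simps)
  have t2: "0 < t\<^sup>2" using t by simp
  have "(t - 1)\<^sup>2 > 0" using t by simp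
  then have sq: "2 * t - 1 < t\<^sup>2" by (simp add: power2_eq_square algebra_simps)
  have "(t - 1) * (u * u') \<le> (t - 1) * 1"
    using u t by (intro mult_left_mono mult_le_one) auto
  then have nuu: "\<not> rejects t u u'" using u sq by (simp add: rejects_def)
  have vu: "rejects t v u' \<longleftrightarrow> t\<^sup>2 \<le> v * (t + (t - 1) * u')"
    and uv: "rejects t u v' \<longleftrightarrow> t\<^sup>2 \<le> v' * (t + (t - 1) * u)"
    and vv: "rejects t v v' \<longleftrightarrow> t\<^sup>2 \<le> v * v' * (2 * t - 1)"
    using u v by (auto simp: rejects_def)
  have one: "(1 - w) \<le> \<alpha> * (z - w)"
    if w: "0 \<le> w" "w \<le> 1" "0 \<le> w'" "w' \<le> 1" "1 < z" and r: "t\<^sup>2 \<le> z * (t + (t - 1) * w')"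
    for w w' z
  proof -
    have "(t - 1) * w' \<le> (t - 1) * 1" using w t by (intro mult_left_mono) auto
    then have "z * (t + (t - 1) * w') \<le> z * (t\<^sup>2 * \<alpha>)"
      using w unfolding t\<alpha> by (intro mult_left_mono) auto
    then have "t\<^sup>2 * 1 \<le> t\<^sup>2 * (\<alpha> * z)" using r by (simp add: mult_ac)
    then have z: "1 \<le> \<alpha> * z" using t2 mult_le_cancel_left_pos by blast
    have "(1 - w) * 1 \<le> (1 - w) * (\<alpha> * z)" using w z by (intro mult_left_mono) auto
    also have "\<dots> = \<alpha> * (z * (1 - w))" by (simp add: mult_ac)
    also have "\<dots> \<le> \<alpha> * (z - w)"
      using w \<alpha> by (intro mult_left_mono upper_times_complement_le) auto
    finally show ?thesis by simp
  qed
  have R: "?R = \<alpha> * (v - u) * (v' - u')" by (simp add: \<alpha>_def)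
  have "?L \<le> \<alpha> * (v - u) * (v' - u')"
  proof (cases "rejects t v u'")
    case True
    then have T: "rejects t v v'" using rejects_mono[of t v u' v v'] u v t by auto
    show ?thesis
    proof (cases "rejects t u v'")
      case uv': True
      have b: "(t - 1)\<^sup>2 * ((v - u) * (v' - u')) \<le> t\<^sup>2 * ((v - 1) * (v' - 1))"
        using True uv' by (intro both_rejected_bound) (use t u v vu uv in auto)
      have "t\<^sup>2 * ?L = t\<^sup>2 * ((v - u) * (v' - u')) - t\<^sup>2 * ((v - 1) * (v' - 1))"
        using nuu True T uv' by (simp add: algebra_simps)
      also have "\<dots> \<le> t\<^sup>2 * ((v - u) * (v' - u')) - (t - 1)\<^sup>2 * ((v - u) * (v' - u'))"
        using b by simp
      also have "\<dots> = (t\<^sup>2 * \<alpha>) * ((v - u) * (v' - u'))"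
        unfolding t\<alpha> by (simp add: power2_eq_square algebra_simps)
      also have "\<dots> = t\<^sup>2 * (\<alpha> * (v - u) * (v' - u'))" by (simp add: mult_ac)
      finally show ?thesis using t2 mult_le_cancel_left_pos by blast
    next
      case False
      have "?L = (1 - u) * (v' - u')" using nuu True T False by (simp add: algebra_simps)
      also have "\<dots> \<le> (\<alpha> * (v - u)) * (v' - u')"
        using True vu u v by (intro mult_right_mono one[of u u' v]) auto
      finally show ?thesis .
    qed
  next
    case vu': False
    show ?thesis
    proof (cases "rejects t u v'")
      case True
      then have T: "rejects t v v'" using rejects_mono[of t u v' v v'] u v t by auto
      have "?L = (1 - u') * (v - u)" using nuu True T vu' by (simp add: algebra_simps)
      also have "\<dots> \<le> (\<alpha> * (v' - u')) * (v - u)"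
        using True uv u v by (intro mult_right_mono one[of u' u v']) auto
      finally show ?thesis by (simp add: mult_ac)
    next
      case uv': False
      show ?thesis
      proof (cases "rejects t v v'")
        case True
        have "t\<^sup>2 * 1 \<le> t\<^sup>2 * (\<alpha> * (v * v'))"
          using True vv t\<alpha> by (simp add: mult_ac) (metis mult.assoc mult.commute)
        then have z: "1 \<le> \<alpha> * (v * v')" using t2 mult_le_cancel_left_pos by blast
        have "?L = (1 - u) * (1 - u') * 1" using nuu vu' uv' True by simp
        also have "\<dots> \<le> (1 - u) * (1 - u') * (\<alpha> * (v * v'))"
          using u z by (intro mult_left_mono) auto
        also have "\<dots> = \<alpha> * ((v * (1 - u)) * (v' * (1 - u')))" by (simp add: mult_ac)
        also have "\<dots> \<le> \<alpha> * ((v - u) * (v' - u'))"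
          using u v \<alpha> by (intro mult_left_mono mult_mono upper_times_complement_le) auto
        finally show ?thesis by (simp add: mult_ac)
      next
        case False
        then show ?thesis using nuu vu' uv' u v \<alpha> by simp
      qed
    qed
  qed
  then show ?thesis by (simp only: R)
qed

text \<open>\<open>t\<close> solves \<open>1 - \<alpha> = (1 - 1/t)\<^sup>2\<close>.\<close>
lemma level_parameter:
  assumes "0 < \<alpha>" "\<alpha> < 1"
  obtains t :: real where "1 < t" "\<alpha> = 2 / t - 1 / t\<^sup>2"
proof -
  define s where "s = 1 - sqrt (1 - \<alpha>)"
  have "0 < sqrt (1 - \<alpha>)" "sqrt (1 - \<alpha>) < 1" using assms by auto
  then have s: "0 < s" "s < 1" by (auto simp: s_def)
  have "(sqrt (1 - \<alpha>))\<^sup>2 = 1 - \<alpha>" using assms by simp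
  then have "\<alpha> = 2 * s - s\<^sup>2" by (simp add: s_def power2_eq_square algebra_simps)
  with s show thesis by (intro that[of "1 / s"]) (auto simp: power2_eq_square)
qed

lemma K2_ad_bounds:
  assumes x: "x \<in> nonneg_orthant"
  shows "0 < K2_ad x" "K2_ad x \<le> 1"
proof -
  define a b where "a = min (x $ 1) (x $ 2)" and "b = max (x $ 1) (x $ 2)"
  have a: "0 \<le> a" using x by (auto simp: a_def nonneg_orthant_def)
  have K: "K2_ad x = (if b \<le> 1 then 1 else if a < 1 then 2 / tau a b - 1 / (tau a b)\<^sup>2
      else 1 / (a * b))"
    by (simp add: K2_ad_eq_ordered K2_ad_ordered_def a_def b_def)
  have mid: "0 < 2 / s - 1 / s\<^sup>2" "2 / s - 1 / s\<^sup>2 \<le> 1" if "1 < s" for s :: real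
  proof -
    have "2 / s - 1 / s\<^sup>2 = (2 * s - 1) / s\<^sup>2" using that by (simp add: power2_eq_square field_simps)
    also have "\<dots> > 0" using that by simp
    finally show "0 < 2 / s - 1 / s\<^sup>2" .
    have "0 \<le> (1 - 1 / s)\<^sup>2" by simp
    also have "\<dots> = 1 - (2 / s - 1 / s\<^sup>2)" by (simp add: power2_eq_square algebra_simps)
    finally show "2 / s - 1 / s\<^sup>2 \<le> 1" by simp
  qed
  have "1 < tau a b" if "a < 1" "1 < b"
    using tau_quadratic(2)[of a b] a that by simp
  moreover have "1 \<le> a * b" if "1 \<le> a" "1 < b"
    using mult_mono[of 1 a 1 b] that by simp
  ultimately show "0 < K2_ad x" "K2_ad x \<le> 1"
    using mid a unfolding K by (auto simp: not_le not_less)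
qed

lemma e_to_p_merger_K2_ad: "e_to_p_merger K2_ad"
  unfolding e_to_p_merger_def
proof (intro conjI allI impI ballI)
  have "K2_ad \<in> borel_measurable borel"
    unfolding K2_ad_def tau_def Let_def by measurable
  then show "K2_ad \<in> borel_measurable (restrict_space borel nonneg_orthant)"
    by (rule measurable_restrict_space1)
  show "K2_ad x \<in> {0..1}" if "x \<in> nonneg_orthant" for x
    using K2_ad_bounds[OF that] by simp
  fix M :: "(real^2) measure" and E :: "2 \<Rightarrow> real^2 \<Rightarrow> real" and \<alpha> :: real
  assume *: "prob_space M \<and> (\<forall>i. e_variable M (E i)) \<and>
        prob_space.indep_vars M (\<lambda>_. borel) E UNIV" and \<alpha>: "\<alpha> \<in> {0..1}"
  then interpret prob_space M by simp
  have nn: "(\<chi> i. E i \<omega>) \<in> nonneg_orthant" if "\<omega> \<in> space M" for \<omega>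
    using * that by (auto simp: e_variable_def nonneg_orthant_def)
  consider "\<alpha> = 0" | "\<alpha> = 1" | "0 < \<alpha>" "\<alpha> < 1" using \<alpha> by fastforce
  then show "prob {\<omega> \<in> space M. K2_ad (\<chi> i. E i \<omega>) \<le> \<alpha>} \<le> \<alpha>"
  proof cases
    case 1
    then have "{\<omega> \<in> space M. K2_ad (\<chi> i. E i \<omega>) \<le> \<alpha>} = {}"
      using K2_ad_bounds(1)[OF nn] by (auto simp: not_le)
    then show ?thesis using 1 by (simp only: measure_empty)
  next
    case 2
    then show ?thesis by simp
  next
    case 3
    then obtain t where t: "1 < t" and \<alpha>t: "\<alpha> = 2 / t - 1 / t\<^sup>2" by (rule level_parameter)
    have "indep_var borel (E 1) borel (E 2)"
      using indep_vars_sum[of "{2}" 1 E] * by (simp add: UNIV_2[symmetric])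
    moreover have "Measurable.pred (borel \<Otimes>\<^sub>M borel) (\<lambda>(x, y). rejects t x y)"
      unfolding rejects_def by measurable
    ultimately have "prob {\<omega> \<in> space M. rejects t (E 1 \<omega>) (E 2 \<omega>)} \<le> \<alpha>"
      unfolding \<alpha>t using *
      by (intro prob_le_by_two_point_laws four_point_bound t) (auto intro: rejects_mono[OF _ _ _ _ _ t])
    also have "{\<omega> \<in> space M. rejects t (E 1 \<omega>) (E 2 \<omega>)} = {\<omega> \<in> space M. K2_ad (\<chi> i. E i \<omega>) \<le> \<alpha>}"
    proof (rule Collect_cong, rule conj_cong[OF refl])
      fix \<omega> assume "\<omega> \<in> space M"
      from nn[OF this] show "rejects t (E 1 \<omega>) (E 2 \<omega>) \<longleftrightarrow> K2_ad (\<chi> i. E i \<omega>) \<le> \<alpha>"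
        unfolding \<alpha>t by (subst K2_ad_le_iff[OF _ _ t]) (auto simp: nonneg_orthant_def)
    qed
    finally show ?thesis .
  qed
qed

section \<open>The closed form of the Dirichlet probability\<close>

text \<open>The coordinate \<open>D\<^sub>0\<close> is eliminated; the Dirichlet law with unit parameters has constant density 2
  on the remaining triangle.\<close>
definition simplex_part :: "real \<Rightarrow> real \<Rightarrow> (real \<times> real) set" where
  "simplex_part x y = {(d1, d2). 0 < d1 \<and> 0 < d2 \<and> d1 + d2 < 1 \<and> x * d1 + y * d2 \<le> 1}"

lemma sets_simplex_part [measurable]: "simplex_part x y \<in> sets borel"
proof -
  have "Measurable.pred (borel \<Otimes>\<^sub>M borel) (\<lambda>(d1, d2::real). 0 < d1 \<and> 0 < d2 \<and> d1 + d2 < 1 \<and> x * d1 + y * d2 \<le> 1)"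
    by measurable
  from predE[OF this] show ?thesis
    unfolding simplex_part_def borel_prod[symmetric] by (simp add: space_pair_measure)
qed

lemma K2_eq_area: "ennreal (K2 x) = 2 * emeasure lborel (simplex_part (x $ 1) (x $ 2))"
proof -
  define D where "D = density lborel (\<lambda>d. ennreal (dirichlet3_density 1 1 1 d))"
  define B where "B = {(d0::real, d1, d2). x $ 1 * d1 + x $ 2 * d2 \<le> 1}"
  have dens: "dirichlet3_density 1 1 1 = (\<lambda>d. 2 * indicator {(d1, d2). 0 < d1 \<and> 0 < d2 \<and> d1 + d2 < 1} d)"
    using Gamma_fact[of 2, where 'a=real]
    by (auto simp: dirichlet3_density_def fun_eq_iff numeral_2_eq_2[symmetric])
  have T: "{(d1, d2::real). 0 < d1 \<and> 0 < d2 \<and> d1 + d2 < 1} \<in> sets borel"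
    using sets_simplex_part[of 0 0] by (simp add: simplex_part_def)
  have B: "B \<in> sets borel"
  proof -
    have "Measurable.pred (borel \<Otimes>\<^sub>M (borel \<Otimes>\<^sub>M borel)) (\<lambda>(d0::real, d1, d2). x $ 1 * d1 + x $ 2 * d2 \<le> 1)"
      by measurable
    from predE[OF this] show ?thesis
      unfolding B_def borel_prod[symmetric] by (simp add: space_pair_measure)
  qed
  have g: "(\<lambda>(d1::real, d2). (1 - d1 - d2, d1, d2)) \<in> D \<rightarrow>\<^sub>M borel"
  proof -
    have "(\<lambda>d::real \<times> real. (1 - fst d - snd d, fst d, snd d)) \<in> borel \<rightarrow>\<^sub>M borel"
      by (intro borel_measurable_continuous_onI continuous_intros)
    then show ?thesis by (simp add: D_def case_prod_unfold)
  qed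
  have "emeasure (dirichlet3 1 1 1) B = emeasure D ((\<lambda>(d1, d2). (1 - d1 - d2, d1, d2)) -` B \<inter> space D)"
    unfolding dirichlet3_def D_def[symmetric] by (rule emeasure_distr[OF g B])
  also have "(\<lambda>(d1, d2). (1 - d1 - d2, d1, d2)) -` B \<inter> space D = {(d1, d2). x $ 1 * d1 + x $ 2 * d2 \<le> 1}"
    by (auto simp: B_def D_def)
  also have "emeasure D \<dots> = (\<integral>\<^sup>+d. ennreal (dirichlet3_density 1 1 1 d) * indicator {(d1, d2). x $ 1 * d1 + x $ 2 * d2 \<le> 1} d \<partial>lborel)"
    unfolding D_def
  proof (rule emeasure_density)
    show "(\<lambda>d. ennreal (dirichlet3_density 1 1 1 d)) \<in> borel_measurable lborel"
      unfolding dens using T by measurable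
    have "Measurable.pred (borel \<Otimes>\<^sub>M borel) (\<lambda>(d1, d2). x $ 1 * d1 + x $ 2 * d2 \<le> 1)"
      by measurable
    from predE[OF this] show "{(d1, d2). x $ 1 * d1 + x $ 2 * d2 \<le> 1} \<in> sets lborel"
      unfolding sets_lborel borel_prod[symmetric] by (simp add: space_pair_measure)
  qed
  also have "\<dots> = (\<integral>\<^sup>+d. 2 * indicator (simplex_part (x $ 1) (x $ 2)) d \<partial>lborel)"
    unfolding dens by (intro nn_integral_cong) (auto simp: simplex_part_def indicator_def split: if_splits)
  also have "\<dots> = 2 * emeasure lborel (simplex_part (x $ 1) (x $ 2))"
    by (simp add: nn_integral_cmult_indicator)
  finally have e: "emeasure (dirichlet3 1 1 1) B = 2 * emeasure lborel (simplex_part (x $ 1) (x $ 2))" .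
  have "emeasure lborel (simplex_part (x $ 1) (x $ 2)) \<le> emeasure lborel (cbox (0, 0) (1, 1) :: (real \<times> real) set)"
  proof (rule emeasure_mono)
    show "simplex_part (x $ 1) (x $ 2) \<subseteq> cbox (0, 0) (1, 1)"
      by (auto simp: simplex_part_def cbox_Pair_eq)
  qed simp
  also have "\<dots> < \<infinity>" by (rule emeasure_lborel_cbox_finite)
  finally have "emeasure (dirichlet3 1 1 1) B < \<infinity>"
    unfolding e by (simp add: ennreal_mult_less_top)
  then have "emeasure (dirichlet3 1 1 1) B = ennreal (K2 x)"
    unfolding K2_def B_def[symmetric] by (intro emeasure_eq_ennreal_measure) auto
  then show ?thesis using e by simp
qed

lemma area_simplex_part_commute: "emeasure lborel (simplex_part x y) = emeasure lborel (simplex_part y x)"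
proof -
  interpret lborel_pair: pair_sigma_finite lborel "lborel :: real measure" ..
  have m: "(\<lambda>(x, y). (y, x)) \<in> (lborel \<Otimes>\<^sub>M lborel) \<rightarrow>\<^sub>M (lborel \<Otimes>\<^sub>M (lborel :: real measure) :: (real \<times> real) measure)"
    by measurable
  have "emeasure (lborel \<Otimes>\<^sub>M lborel) (simplex_part x y)
      = emeasure (distr (lborel \<Otimes>\<^sub>M lborel) (lborel \<Otimes>\<^sub>M lborel) (\<lambda>(x, y). (y, x))) (simplex_part x y)"
    by (simp only: lborel_pair.distr_pair_swap[symmetric])
  also have "\<dots> = emeasure (lborel \<Otimes>\<^sub>M lborel) ((\<lambda>(x, y). (y, x)) -` simplex_part x y \<inter> space (lborel \<Otimes>\<^sub>M lborel))"
    by (rule emeasure_distr[OF m]) (simp only: lborel_prod sets_lborel sets_simplex_part)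
  also have "(\<lambda>(x, y). (y, x)) -` simplex_part x y \<inter> space (lborel \<Otimes>\<^sub>M lborel) = simplex_part y x"
    by (auto simp: simplex_part_def space_pair_measure)
  finally show ?thesis by (simp add: lborel_prod)
qed

text \<open>Cavalieri's principle for a region whose slice lengths are affine on two consecutive intervals,
  the second piece being either a piece of the full triangle (\<open>e = 1\<close>) or empty (\<open>e = 0\<close>).\<close>
lemma area_by_slices:
  fixes m c e r :: real
  assumes A: "A \<in> sets borel" and r: "0 \<le> r" "r \<le> 1" and e: "0 \<le> e"
    and c: "m * r \<le> c" "0 \<le> c"
    and 0: "\<And>s. s \<le> 0 \<or> 1 \<le> s \<Longrightarrow> emeasure lborel (Pair s -` A) = 0"
    and 1: "\<And>s. 0 < s \<Longrightarrow> s < r \<Longrightarrow> emeasure lborel (Pair s -` A) = ennreal (c - m * s)"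
    and 2: "\<And>s. r < s \<Longrightarrow> s < 1 \<Longrightarrow> emeasure lborel (Pair s -` A) = ennreal (e * (1 - s))"
  shows "emeasure lborel A = ennreal (c * r - m * r\<^sup>2 / 2 + e * (1 - r)\<^sup>2 / 2)"
proof -
  have cm: "0 \<le> c - m * s" if "0 \<le> s" "s \<le> r" for s
  proof -
    have "m * s \<le> max 0 (m * r)"
      using that mult_left_mono[of s r m] mult_nonpos_nonneg[of m s] by (cases "0 \<le> m") auto
    then show ?thesis using c by auto
  qed
  have I1: "(\<integral>\<^sup>+s. ennreal (c - m * s) * indicator {0..r} s \<partial>lborel) = ennreal (c * r - m * r\<^sup>2 / 2)"
    by (subst nn_integral_FTC_Icc[where F="\<lambda>s. c * s - m * s\<^sup>2 / 2"])
       (use r cm in \<open>auto intro!: derivative_eq_intros\<close>)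
  have I2: "(\<integral>\<^sup>+s. ennreal (e * (1 - s)) * indicator {r..1} s \<partial>lborel) = ennreal (e * (1 - r)\<^sup>2 / 2)"
    by (subst nn_integral_FTC_Icc[where F="\<lambda>s. - e * (1 - s)\<^sup>2 / 2"])
       (use r e in \<open>auto intro!: derivative_eq_intros mult_left_le_one_le simp: field_simps\<close>)
  have pos: "0 \<le> c * r - m * r\<^sup>2 / 2"
  proof -
    have "0 \<le> r * (c - m * (r / 2))" using cm[of "r / 2"] r by simp
    then show ?thesis by (simp add: power2_eq_square algebra_simps)
  qed
  have "emeasure lborel A = emeasure (lborel \<Otimes>\<^sub>M lborel) A"
    by (simp add: lborel_prod)
  also have "\<dots> = (\<integral>\<^sup>+s. emeasure lborel (Pair s -` A) \<partial>lborel)"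
    using A by (intro lborel.emeasure_pair_measure_alt) (simp only: lborel_prod sets_lborel)
  also have "\<dots> = (\<integral>\<^sup>+s. ennreal (c - m * s) * indicator {0..r} s + ennreal (e * (1 - s)) * indicator {r..1} s \<partial>lborel)"
  proof (rule nn_integral_cong_AE)
    show "AE s in lborel. emeasure lborel (Pair s -` A)
        = ennreal (c - m * s) * indicator {0..r} s + ennreal (e * (1 - s)) * indicator {r..1} s"
      using AE_lborel_singleton[of 0] AE_lborel_singleton[of r] AE_lborel_singleton[of 1]
      by eventually_elim (use 0 1 2 r in \<open>auto simp: indicator_def not_le\<close>)
  qed
  also have "\<dots> = ennreal (c * r - m * r\<^sup>2 / 2) + ennreal (e * (1 - r)\<^sup>2 / 2)"
    by (subst nn_integral_add) (auto simp: I1 I2)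
  also have "\<dots> = ennreal (c * r - m * r\<^sup>2 / 2 + e * (1 - r)\<^sup>2 / 2)"
    using pos e by (simp add: ennreal_plus[symmetric] del: ennreal_plus)
  finally show ?thesis .
qed

lemma slice_simplex_part:
  assumes "0 < s" and b: "0 < b"
  shows "emeasure lborel (Pair s -` simplex_part a b) = ennreal (min (1 - s) ((1 - a * s) / b))"
proof -
  define q where "q = (1 - a * s) / b"
  have "a * s + b * y \<le> 1 \<longleftrightarrow> y \<le> q" for y
    unfolding q_def pos_le_divide_eq[OF b] by (simp add: mult.commute) linarith
  then have mem: "y \<in> Pair s -` simplex_part a b \<longleftrightarrow> 0 < y \<and> y < 1 - s \<and> y \<le> q" for y
    using assms by (auto simp: simplex_part_def)
  have "emeasure lborel (Pair s -` simplex_part a b) = ennreal (min (1 - s) q)"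
  proof (cases "1 - s \<le> q")
    case True
    then have "Pair s -` simplex_part a b = {0<..<1 - s}" unfolding set_eq_iff mem by auto
    then show ?thesis using True by (cases "s \<le> 1") (auto simp: min_def ennreal_neg)
  next
    case False
    then have "Pair s -` simplex_part a b = {0<..q}" unfolding set_eq_iff mem by auto
    then show ?thesis using False by (cases "0 \<le> q") (auto simp: min_def ennreal_neg)
  qed
  then show ?thesis by (simp only: q_def)
qed

lemma slice_simplex_part_outside:
  assumes "s \<le> 0 \<or> 1 \<le> s"
  shows "emeasure lborel (Pair s -` simplex_part a b) = 0"
proof -
  have "Pair s -` simplex_part a b = {}" using assms by (auto simp: simplex_part_def)
  then show ?thesis by simp
qed

definition K2_closed_form :: "real \<Rightarrow> real \<Rightarrow> real" where
  "K2_closed_form a b = (if b \<le> 1 then 1 else if a < 1 then 1 - (b - 1)\<^sup>2 / (b * (b - a)) else 1 / (a * b))"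

text \<open>The slices run along the coordinate multiplied by the smaller coefficient \<open>a\<close>.  For
  \<open>a < 1 < b\<close> the lines \<open>a s + b y = 1\<close> and \<open>s + y = 1\<close> cross at \<open>s = (b - 1)/(b - a)\<close>; for \<open>1 \<le> a\<close> the
  first line leaves the quadrant at \<open>s = 1/a\<close> before they cross.\<close>
lemma area_simplex_part:
  assumes a: "0 \<le> a" "a \<le> b"
  shows "2 * emeasure lborel (simplex_part a b) = ennreal (K2_closed_form a b)"
proof -
  note area = area_by_slices[OF sets_simplex_part[of a b]] and out = slice_simplex_part_outside
  have double: "2 * ennreal z = ennreal (2 * z)" for z
    by (cases "0 \<le> z") (auto simp: ennreal_mult' ennreal_neg)
  consider "b \<le> 1" | "a < 1" "1 < b" | "1 \<le> a" "1 < b" by linarith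
  then show ?thesis
  proof cases
    case 1
    have sl: "emeasure lborel (Pair s -` simplex_part a b) = ennreal (1 * (1 - s))" if "0 < s" "s < 1" for s
    proof -
      have "y < 1 - s \<Longrightarrow> a * s + b * y \<le> 1" if "0 < y" for y
      proof -
        assume "y < 1 - s"
        moreover have "a * s \<le> 1 * s" "b * y \<le> 1 * y"
          using a 1 \<open>0 < s\<close> that by (intro mult_right_mono; simp)+
        ultimately show ?thesis by simp
      qed
      then have "Pair s -` simplex_part a b = {0<..<1 - s}"
        using that by (auto simp: simplex_part_def)
      then show ?thesis using that by simp
    qed
    have "emeasure lborel (simplex_part a b) = ennreal (1 * 0 - 0 * 0\<^sup>2 / 2 + 1 * (1 - 0)\<^sup>2 / 2)"
      by (rule area) (use out sl in auto)
    then have "2 * emeasure lborel (simplex_part a b)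
        = ennreal (2 * (1 * 0 - 0 * 0\<^sup>2 / 2 + 1 * (1 - 0)\<^sup>2 / 2))"
      by (simp only: double)
    then show ?thesis using 1 by (simp add: K2_closed_form_def)
  next
    case 2
    define r where "r = (b - 1) / (b - a)"
    have r: "0 \<le> r" "r < 1" using 2 by (auto simp: r_def divide_simps)
    have br: "(b - a) * r = b - 1" using 2 by (simp add: r_def)
    have cmp: "(1 - a * s) / b \<le> 1 - s \<longleftrightarrow> s \<le> r" for s
      using 2 by (simp add: r_def divide_simps mult_ac) (auto simp: algebra_simps)
    have "emeasure lborel (simplex_part a b)
        = ennreal (1 / b * r - a / b * r\<^sup>2 / 2 + 1 * (1 - r)\<^sup>2 / 2)"
    proof (rule area)
      show "a / b * r \<le> 1 / b"
        using a 2 r mult_le_one[of a r] by (simp add: divide_simps)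
      show "emeasure lborel (Pair s -` simplex_part a b) = ennreal (1 / b - a / b * s)" if "0 < s" "s < r" for s
        using that 2 cmp[of s] by (simp add: slice_simplex_part min_def diff_divide_distrib)
      show "emeasure lborel (Pair s -` simplex_part a b) = ennreal (1 * (1 - s))" if "r < s" "s < 1" for s
        using that r 2 cmp[of s] by (simp add: slice_simplex_part min_def)
    qed (use r 2 out in auto)
    moreover have "2 * (1 / b * r - a / b * r\<^sup>2 / 2 + 1 * (1 - r)\<^sup>2 / 2) = 1 - (b - 1)\<^sup>2 / (b * (b - a))"
    proof -
      have "2 * (1 / b * r - a / b * r\<^sup>2 / 2 + 1 * (1 - r)\<^sup>2 / 2)
          = 1 - (2 * (b - 1) * r - ((b - a) * r) * r) / b"
        using 2 by (simp add: power2_eq_square field_simps)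
      also have "\<dots> = 1 - (b - 1) * r / b" unfolding br by (simp add: algebra_simps)
      also have "\<dots> = 1 - (b - 1)\<^sup>2 / (b * (b - a))" by (simp add: r_def power2_eq_square mult_ac)
      finally show ?thesis .
    qed
    ultimately show ?thesis using 2 by (simp add: double K2_closed_form_def)
  next
    case 3
    have a0: "0 < a" using 3 by simp
    have "emeasure lborel (simplex_part a b)
        = ennreal (1 / b * (1 / a) - a / b * (1 / a)\<^sup>2 / 2 + 0 * (1 - 1 / a)\<^sup>2 / 2)"
    proof (rule area)
      show "emeasure lborel (Pair s -` simplex_part a b) = ennreal (1 / b - a / b * s)" if "0 < s" "s < 1 / a" for s
      proof -
        have "a * s \<le> 1" using that a0 by (simp add: field_simps)
        have "(b - a) * (a * s) \<le> (b - a) * 1"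
          using that a0 a by (intro mult_left_mono) (auto simp: field_simps)
        also have "\<dots> \<le> (b - 1) * a"
          using mult_left_mono[of 1 a b] 3 by (simp add: algebra_simps)
        finally have "a * ((b - a) * s) \<le> a * (b - 1)" by (simp add: mult_ac)
        then have "(b - a) * s \<le> b - 1" using a0 by simp
        then have "1 - a * s \<le> (1 - s) * b" by (simp add: algebra_simps)
        then have "(1 - a * s) / b \<le> 1 - s"
          by (subst pos_divide_le_eq) (use 3 in auto)
        then show ?thesis using that 3 by (simp add: slice_simplex_part min_def diff_divide_distrib)
      qed
      show "emeasure lborel (Pair s -` simplex_part a b) = ennreal (0 * (1 - s))" if "1 / a < s" "s < 1" for s
      proof -
        have s: "0 < s" using that a0 by (meson less_trans zero_less_divide_1_iff)
        have "1 < a * s" using that a0 by (simp add: field_simps)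
        then have "(1 - a * s) / b \<le> 0" using 3 by (simp add: divide_le_0_iff)
        then have "ennreal (min (1 - s) ((1 - a * s) / b)) = 0" by (simp add: min_le_iff_disj ennreal_neg)
        then show ?thesis using s 3 by (simp add: slice_simplex_part)
      qed
    qed (use a0 3 out in auto)
    moreover have "2 * (1 / b * (1 / a) - a / b * (1 / a)\<^sup>2 / 2 + 0 * (1 - 1 / a)\<^sup>2 / 2) = 1 / (a * b)"
      using 3 by (simp add: power2_eq_square field_simps)
    ultimately show ?thesis using 3 by (simp add: double K2_closed_form_def)
  qed
qed

text \<open>Writing \<open>b = t\<^sup>2/s\<close> with \<open>t = tau a b\<close> and \<open>s = t + a (t - 1)\<close> turns the claim into
  \<open>(t - a)\<^sup>2 \<le> t\<^sup>2 - a s\<close>, and the difference of the two sides is \<open>a t (1 - a)\<close>.\<close>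
lemma K2_ad_le_K2_closed_form:
  assumes a: "0 \<le> a" "a < 1" "1 < b"
  shows "2 / tau a b - 1 / (tau a b)\<^sup>2 \<le> 1 - (b - 1)\<^sup>2 / (b * (b - a))"
proof -
  define t where "t = tau a b"
  define s where "s = t + a * (t - 1)"
  have t: "1 < t" "b \<le> t" using tau_quadratic(2)[OF a] a by (auto simp: t_def)
  have q: "b * s = t\<^sup>2"
    using tau_quadratic(1)[OF a] by (simp add: t_def s_def algebra_simps)
  have s: "0 < s" using t a by (simp add: s_def add_pos_nonneg)
  have sb: "s * (b - 1) = (t - 1) * (t - a)"
    using q by (simp add: s_def power2_eq_square algebra_simps)
  have sba: "s * (b - a) = t\<^sup>2 - a * s" using q by (simp add: algebra_simps)
  have le: "(t - a)\<^sup>2 \<le> t\<^sup>2 - a * s"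
  proof -
    have "t\<^sup>2 - a * s - (t - a)\<^sup>2 = a * t * (1 - a)"
      by (simp add: s_def power2_eq_square algebra_simps)
    also have "\<dots> \<ge> 0" using a t by simp
    finally show ?thesis by simp
  qed
  have bp: "0 < b * (b - a)" using a by simp
  have "s\<^sup>2 * (t\<^sup>2 * (b - 1)\<^sup>2) = t\<^sup>2 * (s * (b - 1))\<^sup>2" by (simp add: power_mult_distrib mult_ac)
  also have "\<dots> = t\<^sup>2 * (t - 1)\<^sup>2 * (t - a)\<^sup>2" unfolding sb by (simp add: power_mult_distrib mult_ac)
  also have "\<dots> \<le> t\<^sup>2 * (t - 1)\<^sup>2 * (t\<^sup>2 - a * s)" using le by (intro mult_left_mono) auto
  also have "\<dots> = (t - 1)\<^sup>2 * ((b * s) * (s * (b - a)))" unfolding q sba by (simp add: mult_ac)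
  also have "\<dots> = s\<^sup>2 * ((t - 1)\<^sup>2 * (b * (b - a)))" by (simp add: power2_eq_square mult_ac)
  finally have "t\<^sup>2 * (b - 1)\<^sup>2 \<le> (t - 1)\<^sup>2 * (b * (b - a))" using s by simp
  then have "(b - 1)\<^sup>2 / (b * (b - a)) \<le> (t - 1)\<^sup>2 / t\<^sup>2"
    using bp t by (simp add: divide_simps mult_ac)
  also have "\<dots> = 1 - (2 / t - 1 / t\<^sup>2)"
    using t by (simp add: power2_eq_square field_simps)
  finally show ?thesis by (simp add: t_def)
qed

text \<open>The area identity is one of extended nonnegative reals, where a negative closed form would be
  truncated; its sign comes from the comparison with \<open>K2_ad\<close>.\<close>
lemma K2_eq_closed_form:
  assumes x: "x \<in> nonneg_orthant"
  shows "K2 x = K2_closed_form (min (x $ 1) (x $ 2)) (max (x $ 1) (x $ 2))"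
proof -
  define a b where "a = min (x $ 1) (x $ 2)" and "b = max (x $ 1) (x $ 2)"
  have ab: "0 \<le> a" "a \<le> b" using x by (auto simp: a_def b_def nonneg_orthant_def)
  have "0 \<le> K2_closed_form a b"
  proof (cases "a < 1 \<and> 1 < b")
    case True
    then have t: "1 < tau a b" using tau_quadratic(2)[OF ab(1)] by force
    have "2 / tau a b - 1 / (tau a b)\<^sup>2 = (2 * tau a b - 1) / (tau a b)\<^sup>2"
      using t by (simp add: power2_eq_square field_simps)
    also have "\<dots> \<ge> 0" using t by simp
    also have "2 / tau a b - 1 / (tau a b)\<^sup>2 \<le> K2_closed_form a b"
      using K2_ad_le_K2_closed_form[OF ab(1), of b] True by (simp only: K2_closed_form_def) simp
    finally show ?thesis .
  next
    case False
    then show ?thesis using ab by (auto simp: K2_closed_form_def)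
  qed
  moreover have "emeasure lborel (simplex_part (x $ 1) (x $ 2)) = emeasure lborel (simplex_part a b)"
    using area_simplex_part_commute by (auto simp: a_def b_def min_def max_def)
  then have "ennreal (K2 x) = ennreal (K2_closed_form a b)"
    by (simp add: K2_eq_area area_simplex_part[OF ab])
  moreover have "0 \<le> K2 x" by (simp add: K2_def)
  ultimately show ?thesis by (simp add: a_def b_def)
qed

lemma dominates_K2_ad_K2: "dominates K2_ad K2"
  unfolding dominates_def
proof
  fix x :: "real^2" assume x: "x \<in> nonneg_orthant"
  define a b where "a = min (x $ 1) (x $ 2)" and "b = max (x $ 1) (x $ 2)"
  have "0 \<le> a" using x by (auto simp: a_def nonneg_orthant_def)
  then show "K2_ad x \<le> K2 x"
    using K2_ad_le_K2_closed_form[of a b]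
    by (simp add: K2_eq_closed_form[OF x] K2_closed_form_def K2_ad_eq_ordered K2_ad_ordered_def a_def[symmetric] b_def[symmetric])
qed

section \<open>The lower bound for mergers below the Dirichlet probability\<close>

text \<open>What being a merger says about products of two-point laws with masses \<open>p\<close> and \<open>q\<close> at \<open>x2\<close> and
  \<open>y2\<close>, for the event that both second atoms occur and for the event that at least one does.  As a
  property of a curried function it can be passed to the function with exchanged arguments.\<close>
definition two_point_valid :: "(real \<Rightarrow> real \<Rightarrow> real) \<Rightarrow> bool" where
  "two_point_valid G \<longleftrightarrow> (\<forall>x1 x2 p y1 y2 q \<alpha>.
     0 \<le> x1 \<longrightarrow> 0 \<le> x2 \<longrightarrow> p \<in> {0..1} \<longrightarrow> (1 - p) * x1 + p * x2 \<le> 1 \<longrightarrow>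
     0 \<le> y1 \<longrightarrow> 0 \<le> y2 \<longrightarrow> q \<in> {0..1} \<longrightarrow> (1 - q) * y1 + q * y2 \<le> 1 \<longrightarrow>
     \<alpha> \<in> {0..1} \<longrightarrow> G x2 y2 \<le> \<alpha> \<longrightarrow>
       p * q \<le> \<alpha> \<and> (G x1 y2 \<le> \<alpha> \<longrightarrow> G x2 y1 \<le> \<alpha> \<longrightarrow> 1 - (1 - p) * (1 - q) \<le> \<alpha>))"

lemma two_point_valid_merger:
  fixes F :: "real^2 \<Rightarrow> real"
  assumes F: "e_to_p_merger F"
  shows "two_point_valid (\<lambda>x y. F (vector [x, y]))"
  unfolding two_point_valid_def
proof (intro allI impI)
  fix x1 x2 p y1 y2 q \<alpha> :: real
  assume x: "0 \<le> x1" "0 \<le> x2" "p \<in> {0..1}" "(1 - p) * x1 + p * x2 \<le> 1"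
    and y: "0 \<le> y1" "0 \<le> y2" "q \<in> {0..1}" "(1 - q) * y1 + q * y2 \<le> 1"
    and \<alpha>: "\<alpha> \<in> {0..1}" and F22: "F (vector [x2, y2]) \<le> \<alpha>"
  define B where "B = (\<lambda>i::2. bernoulli_pmf (if i = 1 then p else q))"
  define P where "P = Pi_pmf (UNIV :: 2 set) False B"
  define V where "V = (\<lambda>(i::2) b. if i = 1 then (if b then x2 else x1) else (if b then y2 else y1))"
  define E where "E = (\<lambda>i (\<omega> :: 2 \<Rightarrow> bool). V i (\<omega> i))"
  have ind: "prob_space.indep_vars (measure_pmf P) (\<lambda>_. borel) E UNIV"
  proof -
    have "prob_space.indep_vars (measure_pmf P) (\<lambda>_. count_space UNIV) (\<lambda>i \<omega>. \<omega> i) UNIV"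
      unfolding P_def by (rule indep_vars_Pi_pmf) simp
    from prob_space.indep_vars_compose2[OF measure_pmf.prob_space_axioms this, of V "\<lambda>_. borel"] show ?thesis
      by (simp add: E_def)
  qed
  have comp: "map_pmf (\<lambda>\<omega>. \<omega> i) P = B i" for i
    unfolding P_def by (subst Pi_pmf_component) auto
  have ev: "e_variable (measure_pmf P) (E i)" for i
    unfolding e_variable_def
  proof (intro conjI ballI)
    show "0 \<le> E i \<omega>" for \<omega> using x y by (simp add: E_def V_def)
    show "integrable (measure_pmf P) (E i)"
      by (rule measure_pmf.integrable_const_bound[where B="x1 + x2 + y1 + y2"])
         (use x y in \<open>auto simp: E_def V_def\<close>)
    have "measure_pmf.expectation P (E i) = measure_pmf.expectation (map_pmf (\<lambda>\<omega>. \<omega> i) P) (V i)"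
      by (simp add: E_def)
    also have "\<dots> \<le> 1"
      unfolding comp B_def using x y by (cases "i = 1") (auto simp: V_def mult_ac add_ac)
    finally show "measure_pmf.expectation P (E i) \<le> 1" .
  qed
  have bound: "measure_pmf.prob P A \<le> \<alpha>" if "\<And>\<omega>. \<omega> \<in> A \<Longrightarrow> F (vector [E 1 \<omega>, E 2 \<omega>]) \<le> \<alpha>" for A
  proof -
    have v: "(\<chi> i. E i \<omega>) = vector [E 1 \<omega>, E 2 \<omega>]" for \<omega>
      by (simp add: vec_eq_iff forall_2)
    have "measure_pmf.prob P A \<le> measure_pmf.prob P {\<omega> \<in> space (measure_pmf P). F (\<chi> i. E i \<omega>) \<le> \<alpha>}"
      using that by (intro measure_pmf.finite_measure_mono) (auto simp: v)
    also have "\<dots> \<le> \<alpha>"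
      by (rule e_to_p_merger_any_space[OF F _ ev ind \<alpha>]) (rule measure_pmf.prob_space_axioms)
    finally show ?thesis .
  qed
  have box: "measure_pmf.prob P {\<omega>. \<omega> 1 = b \<and> \<omega> 2 = c} = pmf (B 1) b * pmf (B 2) c" for b c
  proof -
    have "{\<omega>. \<omega> 1 = b \<and> \<omega> 2 = c} = Pi UNIV (\<lambda>i::2. {if i = 1 then b else c})"
      unfolding Pi_def forall_2 by auto
    then have "measure_pmf.prob P {\<omega>. \<omega> 1 = b \<and> \<omega> 2 = c}
        = (\<Prod>i\<in>UNIV. measure_pmf.prob (B i) {if i = 1 then b else c})"
      unfolding P_def by (simp add: measure_Pi_pmf_Pi)
    then show ?thesis by (simp add: UNIV_2 measure_pmf_single)
  qed
  show "p * q \<le> \<alpha> \<and> (F (vector [x1, y2]) \<le> \<alpha> \<longrightarrow> F (vector [x2, y1]) \<le> \<alpha> \<longrightarrow> 1 - (1 - p) * (1 - q) \<le> \<alpha>)"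
  proof (intro conjI impI)
    have "measure_pmf.prob P {\<omega>. \<omega> 1 = True \<and> \<omega> 2 = True} \<le> \<alpha>"
      by (rule bound) (use F22 in \<open>auto simp: E_def V_def\<close>)
    then show "p * q \<le> \<alpha>" using x y unfolding box by (simp add: B_def)
    assume F12: "F (vector [x1, y2]) \<le> \<alpha>" and F21: "F (vector [x2, y1]) \<le> \<alpha>"
    have "measure_pmf.prob P (space P - {\<omega>. \<omega> 1 = False \<and> \<omega> 2 = False}) \<le> \<alpha>"
      by (rule bound) (use F22 F12 F21 in \<open>auto simp: E_def V_def\<close>)
    then have "1 - measure_pmf.prob P {\<omega>. \<omega> 1 = False \<and> \<omega> 2 = False} \<le> \<alpha>"
      by (subst (asm) measure_pmf.prob_compl) auto
    then show "1 - (1 - p) * (1 - q) \<le> \<alpha>" using x y unfolding box by (simp add: B_def)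
  qed
qed

lemma vec_eq_vector_2: "(x :: real^2) = vector [x $ 1, x $ 2]"
  by (simp add: vec_eq_iff forall_2)

lemma two_point_valid_swap:
  assumes "two_point_valid G"
  shows "two_point_valid (\<lambda>x y. G y x)"
  unfolding two_point_valid_def
proof (intro allI impI, goal_cases)
  case (1 x1 x2 p y1 y2 q \<alpha>)
  have "q * p \<le> \<alpha> \<and>
      (G y1 x2 \<le> \<alpha> \<longrightarrow> G y2 x1 \<le> \<alpha> \<longrightarrow> 1 - (1 - q) * (1 - p) \<le> \<alpha>)"
    by (rule assms[unfolded two_point_valid_def, rule_format]) (fact 1)+
  then show ?case by (metis mult.commute)
qed

text \<open>Each case is the two-point law that is extremal for that region.  For \<open>a < 1 < b\<close> the product of
  the laws on \<open>{a, t}\<close> and \<open>{0, b}\<close> with \<open>t = tau a b\<close> meets the bound with equality, which is no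
  contradiction; hence \<open>t\<close> is taken slightly larger and then sent to \<open>tau a b\<close>.\<close>
lemma K2_ad_ordered_lower:
  assumes G: "two_point_valid G"
    and G01: "\<And>x y. 0 \<le> x \<Longrightarrow> 0 \<le> y \<Longrightarrow> G x y \<in> {0..1}"
    and edge: "\<And>t. 1 < t \<Longrightarrow> G t 0 \<le> 2 / t - 1 / t\<^sup>2"
    and inner: "\<And>s t. 1 \<le> s \<Longrightarrow> 1 < t \<Longrightarrow> G s t \<le> 1 / (s * t)"
    and ab: "0 \<le> a" "a \<le> b"
  shows "K2_ad_ordered a b \<le> G a b"
proof -
  have Gab: "G a b \<in> {0..1}" using G01 ab by simp
  note G' = G[unfolded two_point_valid_def, rule_format]
  consider "b \<le> 1" | "a < 1" "1 < b" | "1 \<le> a" "1 < b" by linarith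
  then show ?thesis
  proof cases
    case 1
    have "1 * 1 \<le> G a b"
      using G'[of a a 1 b b 1 "G a b"] 1 ab Gab by simp
    then show ?thesis using 1 by (simp add: K2_ad_ordered_def)
  next
    case 3
    have "1 / a * (1 / b) \<le> G a b"
      using G'[of 0 a "1 / a" 0 b "1 / b" "G a b"] 3 ab Gab by simp
    then show ?thesis using 3 by (simp add: K2_ad_ordered_def)
  next
    case 2
    define T where "T = tau a b"
    have T: "b \<le> T" using tau_quadratic(2)[OF ab(1) 2] by (simp add: T_def)
    have above: "2 / t - 1 / t\<^sup>2 \<le> G a b" if t: "T < t" for t
    proof (rule ccontr)
      define \<alpha> where "\<alpha> = 2 / t - 1 / t\<^sup>2"
      define p where "p = (1 - a) / (t - a)"
      assume "\<not> 2 / t - 1 / t\<^sup>2 \<le> G a b"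
      then have Ga: "G a b \<le> \<alpha>" by (simp add: \<alpha>_def)
      have t1: "1 < t" using t T 2 by simp
      have \<alpha>1: "1 - \<alpha> = ((t - 1) / t)\<^sup>2" using t1 by (simp add: \<alpha>_def power2_eq_square field_simps)
      have "\<alpha> \<le> 1" using \<alpha>1 zero_le_power2[of "(t - 1) / t"] by linarith
      then have \<alpha>: "\<alpha> \<in> {0..1}" using Ga Gab by auto
      have "1 / (t * b) \<le> 1 / t"
        using t1 2 by (simp add: field_simps)
      also have "\<dots> \<le> \<alpha>"
      proof -
        have "\<alpha> - 1 / t = 1 / t * (1 - 1 / t)"
          by (simp add: \<alpha>_def power2_eq_square algebra_simps)
        also have "\<dots> \<ge> 0" using t1 by simp
        finally show ?thesis by simp
      qed
      finally have Gtb: "G t b \<le> \<alpha>" using inner[of t b] t1 2 by simp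
      have p: "p \<in> {0..1}" "(1 - p) * a + p * t \<le> 1" "1 - p = (t - 1) / (t - a)"
        using 2 t1 by (auto simp: p_def divide_simps) (auto simp: algebra_simps)
      \<comment> \<open>If \<open>(a, b)\<close> were rejected as well, only the pair \<open>(a, 0)\<close> could be accepted.\<close>
      have "1 - (1 - p) * (1 - 1 / b) \<le> \<alpha>"
        using G'[of a t p 0 b "1 / b" \<alpha>] p \<alpha> Ga Gtb edge[of t] ab 2 t1 by (simp add: \<alpha>_def)
      then have "((t - 1) / t)\<^sup>2 \<le> (t - 1) / (t - a) * ((b - 1) / b)"
        using \<alpha>1 2 by (simp add: p(3) diff_divide_distrib)
      then have "(t - 1) * ((t - 1) * (b * (t - a))) \<le> (t - 1) * (t\<^sup>2 * (b - 1))"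
        using t1 2 by (simp add: power2_eq_square divide_simps) (simp add: mult_ac)
      then have "(t - 1) * (b * (t - a)) \<le> t\<^sup>2 * (b - 1)" using t1 by simp
      then have "t\<^sup>2 \<le> b * (t + a * (t - 1))" by (simp add: power2_eq_square algebra_simps)
      then have "t \<le> T" using quadratic_sign_tau[OF ab(1) 2 t1] by (simp add: T_def)
      then show False using t by simp
    qed
    have "((\<lambda>t. 2 / t - 1 / t\<^sup>2) \<longlongrightarrow> 2 / T - 1 / T\<^sup>2) (at_right T)"
      using T 2 by (intro tendsto_intros) auto
    moreover have "\<forall>\<^sub>F t in at_right T. 2 / t - 1 / t\<^sup>2 \<le> G a b"
      using above by (auto simp: eventually_at_right_less eventually_at_filter)
    ultimately have "2 / T - 1 / T\<^sup>2 \<le> G a b"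
      by (intro tendsto_upperbound[of _ _ "at_right T"]) auto
    then show ?thesis using 2 by (simp add: K2_ad_ordered_def T_def)
  qed
qed

lemma K2_boundary_values:
  assumes "1 < t"
  shows "K2 (vector [t, 0]) = 2 / t - 1 / t\<^sup>2" and "K2 (vector [0, t]) = 2 / t - 1 / t\<^sup>2"
proof -
  have "K2_closed_form 0 t = 2 / t - 1 / t\<^sup>2"
    using assms by (simp add: K2_closed_form_def power2_eq_square field_simps)
  then show "K2 (vector [t, 0]) = 2 / t - 1 / t\<^sup>2" and "K2 (vector [0, t]) = 2 / t - 1 / t\<^sup>2"
    using assms by (simp_all add: K2_eq_closed_form nonneg_orthant_def forall_2)
qed

lemma K2_inner_value:
  assumes "1 \<le> s" "1 \<le> t" "1 < s \<or> 1 < t"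
  shows "K2 (vector [s, t]) = 1 / (s * t)"
proof -
  have "K2_closed_form (min s t) (max s t) = 1 / (s * t)"
    using assms by (auto simp: K2_closed_form_def min_def max_def)
  then show ?thesis
    using assms by (simp add: K2_eq_closed_form nonneg_orthant_def forall_2)
qed

lemma K2_ad_least_merger_below_K2:
  assumes F: "e_to_p_merger F" and le: "\<And>x. x \<in> nonneg_orthant \<Longrightarrow> F x \<le> K2 x"
    and x: "x \<in> nonneg_orthant"
  shows "K2_ad x \<le> F x"
proof -
  have x0: "0 \<le> x $ 1" "0 \<le> x $ 2" using x by (auto simp: nonneg_orthant_def)
  have mem: "vector [s, t] \<in> (nonneg_orthant :: (real^2) set)" if "0 \<le> s" "0 \<le> t" for s t
    using that by (simp add: nonneg_orthant_def forall_2)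
  have F01: "F (vector [s, t]) \<in> {0..1}" if "0 \<le> s" "0 \<le> t" for s t
    using F mem[OF that] by (simp add: e_to_p_merger_def)
  have edge: "F (vector [t, 0]) \<le> 2 / t - 1 / t\<^sup>2" "F (vector [0, t]) \<le> 2 / t - 1 / t\<^sup>2"
    if "1 < t" for t
    using le[OF mem[of t 0]] le[OF mem[of 0 t]] that by (simp_all add: K2_boundary_values)
  have inner: "F (vector [s, t]) \<le> 1 / (s * t)" if "1 \<le> s" "1 \<le> t" "1 < s \<or> 1 < t" for s t
    using le[OF mem[of s t]] that by (simp add: K2_inner_value)
  have valid: "two_point_valid (\<lambda>s t. F (vector [s, t]))" by (rule two_point_valid_merger[OF F])
  show ?thesis
  proof (cases "x $ 1 \<le> x $ 2")
    case True
    have "K2_ad_ordered (x $ 1) (x $ 2) \<le> F (vector [x $ 1, x $ 2])"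
      by (rule K2_ad_ordered_lower[OF valid]) (use F01 edge inner x0 True in auto)
    then show ?thesis using True by (simp add: K2_ad_eq_ordered vec_eq_vector_2[symmetric])
  next
    case False
    have "F (vector [t, s]) \<le> 1 / (s * t)" if "1 \<le> s" "1 < t" for s t
      using inner[of t s] that by (simp add: mult.commute)
    then have "K2_ad_ordered (x $ 2) (x $ 1) \<le> F (vector [x $ 1, x $ 2])"
      by (intro K2_ad_ordered_lower[OF two_point_valid_swap[OF valid]]) (use F01 edge x0 False in auto)
    then show ?thesis using False by (simp add: K2_ad_eq_ordered vec_eq_vector_2[symmetric])
  qed
qed

theorem theorem3p7:
  shows "(\<forall>F :: real^2 \<Rightarrow> real.
            e_to_p_merger F \<and> (\<forall>x\<in>nonneg_orthant. F x \<le> K2 x) \<longrightarrow>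
            (\<forall>x\<in>nonneg_orthant. K2_ad x \<le> F x))
       \<and> admissible_merger K2_ad
       \<and> dominates K2_ad K2
       \<and> (\<forall>F :: real^2 \<Rightarrow> real.
            admissible_merger F \<and> dominates F K2 \<longrightarrow>
            (\<forall>x\<in>nonneg_orthant. F x = K2_ad x))"
proof (intro conjI allI impI ballI)
  show least: "K2_ad x \<le> F x"
    if "e_to_p_merger F \<and> (\<forall>x\<in>nonneg_orthant. F x \<le> K2 x)" "x \<in> nonneg_orthant" for F x
    using that by (intro K2_ad_least_merger_below_K2) auto
  show dom: "dominates K2_ad K2" by (rule dominates_K2_ad_K2)
  have "\<not> strictly_dominates G K2_ad" if G: "e_to_p_merger G" for G
  proof
    assume "strictly_dominates G K2_ad"
    then have le: "\<forall>x\<in>nonneg_orthant. G x \<le> K2_ad x" and "\<exists>x\<in>nonneg_orthant. G x < K2_ad x"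
      by (auto simp: strictly_dominates_def dominates_def)
    moreover have "\<forall>x\<in>nonneg_orthant. G x \<le> K2 x"
      using le dom by (auto simp: dominates_def intro: order_trans)
    ultimately show False using least[of G] G by (meson not_le)
  qed
  then show "admissible_merger K2_ad"
    using e_to_p_merger_K2_ad by (auto simp: admissible_merger_def)
  fix F :: "real^2 \<Rightarrow> real" and x :: "real^2"
  assume F: "admissible_merger F \<and> dominates F K2" and x: "x \<in> nonneg_orthant"
  then have le: "\<forall>x\<in>nonneg_orthant. K2_ad x \<le> F x"
    using least[of F] by (simp add: admissible_merger_def dominates_def)
  moreover have "\<not> strictly_dominates K2_ad F"
    using F e_to_p_merger_K2_ad by (auto simp: admissible_merger_def)
  ultimately show "F x = K2_ad x"
    using x by (force simp: strictly_dominates_def dominates_def not_less)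
qed

end
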